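(* Let $k\in\mathbb N$ be a fixed horizon and run the clipped stochastic subgradient method (C-SsGM) with parameters $\gamma>0$, $\lambda>0$ and the epoch-wise constant stepsizes and clipping levels $$\gamma_i=\frac{\gamma}{2^j k^{1/p}},\qquad \lambda_i=2^j\max\{L_\varepsilon,\lambda k^{1/p}\}\qquad (i\in E_j,\ j\in\{0,1,\dots,n\}),$$ where $n=\lceil\log_2 k\rceil$ and $E_0,\dots,E_n$ are the epochs partitioning $\{1,\dots,k\}$. Let $\mathsf x_*\in\operatorname{argmin}_{\mathsf X} f$ and $f_*=\min_{\mathsf X} f$. Set $v_p=4a_p/\lambda^{p-1}$ and $w_p=b_p\max\{L_\varepsilon,\lambda\}^{2-p}$. Then, for every $k\in\mathbb N$, $$\mathbb E[f(x_k)]-f_*\le \frac{1}{k^{(p-1)/p}}\left[\frac65\,\frac{\|x_1-\mathsf x_*\|^2}{\gamma}+\frac{53}{10}\cdot\frac{2^{p-1}}{2^{p-1}-1}\Big(\|x_1-\mathsf x_*\|\,v_p+\gamma\big(v_p+\sqrt{w_p}\big)^2\Big)\right].$$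
   Context: Setting. $\mathsf H$ is a real separable Hilbert space; $f:\mathsf H\to\mathbb R$ is convex and Lipschitz continuous with constant $L>0$; $\mathsf X\subset\mathsf H$ is nonempty, closed and convex, with orthogonal projection $P_{\mathsf X}$; $\operatorname{argmin}_{\mathsf X} f\ne\varnothing$. $\xi$ is a random variable and for every $\mathsf x\in\mathsf X$, $\hat u(\mathsf x,\xi)$ is an $\mathsf H$-valued random vector ($\hat u$ jointly measurable) with $\mathbb E\|\hat u(\mathsf x,\xi)\|<\infty$ and $\mathbb E[\hat u(\mathsf x,\xi)]\in\partial f(\mathsf x)$ (convex subdifferential). For some $p\in\,]1,2]$ and $\sigma\ge 0$, $\mathbb E\|\hat u(\mathsf x,\xi)-\mathbb E[\hat u(\mathsf x,\xi)]\|^p\le\sigma^p$ for every $\mathsf x\in\mathsf X$. Constants. Fix a batch size $m\ge1$ and $\varepsilon>0$. Let $\sigma_m\ge0$ be such that for all $\mathsf x\in\mathsf X$, $\mathbb E\|\bar u-\mathbb E\bar u\|^p\le\sigma_m^p$, where $\bar u=\frac1m\sum_{i=1}^m\hat u(\mathsf x,\xi_i)$ with $\xi_1,\dots,\xi_m$ i.i.d. copies of $\xi$. Set $a_p=(1+1/\varepsilon)^{p-1}\sigma_m^p$, $b_p=2^{p-1}(\sigma_m^p+L^p)$, $L_\varepsilon=(1+\varepsilon)L$. Algorithm (C-SsGM). For $\mathsf u\in\mathsf H$ and $\lambda>0$ let $\mathrm{CLIP}(\mathsf u,\lambda)=\max\{\|\mathsf u\|/\lambda,1\}^{-1}\mathsf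 u$. Given stepsizes $\gamma_i>0$, clipping levels $\lambda_i>0$ and a deterministic $x_1\in\mathsf X$, for $i=1,2,\dots$: draw $\boldsymbol\xi^i=(\xi^i_1,\dots,\xi^i_m)$, $m$ independent copies of $\xi$ (the $\boldsymbol\xi^i$ being mutually independent); set $\bar u_i=\frac1m\sum_{j=1}^m\hat u(x_i,\xi^i_j)$, $\tilde u_i=\mathrm{CLIP}(\bar u_i,\lambda_i)$, $x_{i+1}=P_{\mathsf X}(x_i-\gamma_i\tilde u_i)$. Epochs. For the horizon $k$, $n=\lceil\log_2 k\rceil$, $k_j=k-\lceil k/2^j\rceil$ for $j=0,1,\dots,n$, $k_{n+1}=k$, and $E_j=\{k_j+1,\dots,k_{j+1}\}$ for $j=0,\dots,n$. *)

theory Defs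
  imports "HOL-Probability.Probability"
begin

definition subdifferential :: "('h::real_inner \<Rightarrow> real) \<Rightarrow> 'h \<Rightarrow> 'h set" where
  "subdifferential f x = {g. \<forall>y. f y \<ge> f x + inner g (y - x)}"

text \<open>The library's \<^const>\<open>closest_point\<close> requires a Heine-Borel space, which excludes
  infinite-dimensional Hilbert spaces.\<close>

definition proj :: "'h::real_inner set \<Rightarrow> 'h \<Rightarrow> 'h" where
  "proj X a = (THE x. x \<in> X \<and> (\<forall>y\<in>X. dist a x \<le> dist a y))"

definition clip :: "'h::real_normed_vector \<Rightarrow> real \<Rightarrow> 'h" where
  "clip u l = inverse (max (norm u / l) 1) *\<^sub>R u"

definition batch_mean :: "nat \<Rightarrow> ('h::real_normed_vector \<Rightarrow> 's \<Rightarrow> 'h) \<Rightarrow> 'h \<Rightarrow> (nat \<Rightarrow> 's) \<Rightarrow> 'h" where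
  "batch_mean m u x s = (1 / real m) *\<^sub>R (\<Sum>j\<in>{1..m}. u x (s j))"

text \<open>\<^const>\<open>prob_space.indep_vars\<close> also contains the measurability of each \<open>zeta j\<close>.\<close>

definition iid_copies ::
  "'w measure \<Rightarrow> 's measure \<Rightarrow> ('w \<Rightarrow> 's) \<Rightarrow> nat set \<Rightarrow> (nat \<Rightarrow> 'w \<Rightarrow> 's) \<Rightarrow> bool" where
  "iid_copies M S xi J zeta \<longleftrightarrow>
     prob_space.indep_vars M (\<lambda>_. S) zeta J \<and> (\<forall>j\<in>J. distr M S (zeta j) = distr M S xi)"

definition last_epoch :: "nat \<Rightarrow> nat" where
  "last_epoch k = nat \<lceil>log 2 (real k)\<rceil>"

definition epoch_bound :: "nat \<Rightarrow> nat \<Rightarrow> nat" where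
  "epoch_bound k j =
     (if j \<le> last_epoch k then k - nat \<lceil>real k / 2 ^ j\<rceil> else k)"

definition epoch :: "nat \<Rightarrow> nat \<Rightarrow> nat set" where
  "epoch k j = {epoch_bound k j + 1..epoch_bound k (j + 1)}"

end

theory Submission
  imports Defs
begin

text \<open>
  Write \<open>\<theta>\<^sub>i = 2^-j\<close> on the epoch \<open>E\<^sub>j\<close>, so that the step size is proportional and the clipping level inversely
  proportional to \<open>\<theta>\<^sub>i\<close>. Clipping at level \<open>l \<ge> (1 + \<epsilon>) L\<close> costs a bias of order \<open>\<sigma>^p / l^(p-1)\<close> and
  leaves a second moment of order \<open>l^(2-p)\<close>; with the given parameters both enter the recursion for
  \<open>E \<parallel>x\<^sub>i - z\<parallel>^2\<close> with the same weight \<open>\<theta>\<^sub>i^p / k\<close>. These weights sum to at most 1, so \<open>E \<parallel>x\<^sub>i - x\<^sub>*\<parallel>\<close> stays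
  bounded, and the noise in each step is at most a constant times \<open>\<theta>\<^sub>i^p / k\<close>. Taking for \<open>z\<close> the
  best iterate of the epoch \<open>E\<^sub>j\<close> shows that the best iterate of the next epoch is worse by at most a multiple of
  \<open>2^(-j(p-1))\<close>; the sum of this geometric series bounds the loss up to the last epoch, which is \<open>{k}\<close>.
\<close>

subsection \<open>Projection and clipping\<close>

text \<open>\<open>X\<close> may be unbounded, and the clipping bias is multiplied by the distance
  to the reference point. No diameter is available, so the recursion against the minimiser must
  deliver a bound on mean distances before any other reference is tried. With an earlier iterate x_t
  as reference, the telescoped sum starts at distance 0 and leaves only noise; hence epochs can be
  compared without a new distance term. The price is a random reference point. The index t is chosen
  through the expectations of \<open>f\<close>, so it is deterministic, and x_t is a function of the
  batches before i. The pair (x_i, x_t) is therefore independent of batch i, and an inequality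
  proved for fixed points can be integrated by Fubini. An epoch is at most 3 times as long as the
  next one, whose weight is half as large. This gives the cost 7 = 2 * 3 + 1 per epoch, and the
  start adds 1. The factor 2 of the expanded square halves the sum to (1 + 7 C) / 2 \<le> 4 C with C
  = 1 / (1 - (1/2)^(p-1)), which fits under 53/10 C.\<close>

lemma proj_unique_exists:
  fixes X :: "'h::{real_inner, complete_space} set"
  assumes "closed X" "convex X" "X \<noteq> {}"
  shows "\<exists>!x. x \<in> X \<and> (\<forall>y\<in>X. dist a x \<le> dist a y)"
proof -
  define d where "d = infdist a X"
  have d_le: "d \<le> dist a y" if "y \<in> X" for y
    using that by (simp add: d_def infdist_le)
  have d_nonneg: "0 \<le> d" by (simp add: d_def infdist_nonneg)
  \<comment> \<open>Parallelogram identity: the midpoint of \<open>y\<close> and \<open>z\<close> is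
    in \<open>X\<close> by convexity, so its distance from \<open>a\<close> is at least
    \<open>d\<close>. The inequality makes minimising sequences Cauchy and two minimisers equal;
    completeness takes the place of compactness.\<close>
  have par: "(dist y z)\<^sup>2 \<le> 2 * ((dist a y)\<^sup>2 - d\<^sup>2) + 2 * ((dist a z)\<^sup>2 - d\<^sup>2)"
    if "y \<in> X" "z \<in> X" for y z
  proof -
    have "(1/2) *\<^sub>R y + (1/2) *\<^sub>R z \<in> X"
      using that assms(2) by (simp add: convexD)
    then have "d\<^sup>2 \<le> (dist a ((1/2) *\<^sub>R y + (1/2) *\<^sub>R z))\<^sup>2"
      using d_le d_nonneg by (simp add: power_mono)
    then show ?thesis
      by (simp add: dist_norm power2_norm_eq_inner inner_simps inner_commute algebra_simps)
  qed
  have "\<exists>y\<in>X. dist a y < d + inverse (real (Suc n))" for n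
  proof -
    have "(INF y\<in>X. dist a y) < d + inverse (real (Suc n))"
      using assms(3) by (simp add: d_def infdist_notempty)
    then show ?thesis
      using assms(3) by (subst (asm) cINF_less_iff) (auto intro: bdd_belowI2[of _ 0])
  qed
  then obtain s where s: "\<And>n. s n \<in> X" "\<And>n. dist a (s n) < d + inverse (real (Suc n))"
    by metis
  have lim: "(\<lambda>n. dist a (s n)) \<longlonglongrightarrow> d"
  proof (rule tendsto_sandwich)
    show "\<forall>\<^sub>F n in sequentially. d \<le> dist a (s n)"
      using s(1) d_le by simp
    show "\<forall>\<^sub>F n in sequentially. dist a (s n) \<le> d + inverse (real (Suc n))"
      using s(2) by (intro always_eventually allI less_imp_le)
    show "(\<lambda>n. d + inverse (real (Suc n))) \<longlonglongrightarrow> d"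
      using tendsto_add[OF tendsto_const LIMSEQ_inverse_real_of_nat, of d] by simp
  qed simp
  have lim2: "(\<lambda>n. (dist a (s n))\<^sup>2 - d\<^sup>2) \<longlonglongrightarrow> 0"
    using tendsto_diff[OF tendsto_power[OF lim, of 2] tendsto_const, of "d\<^sup>2"] by simp
  have "Cauchy s"
  proof (rule metric_CauchyI)
    fix e :: real assume "e > 0"
    then have "\<forall>\<^sub>F n in sequentially. (dist a (s n))\<^sup>2 - d\<^sup>2 < e\<^sup>2 / 4"
      by (intro order_tendstoD(2)[OF lim2]) auto
    then obtain N where N: "\<And>n. n \<ge> N \<Longrightarrow> (dist a (s n))\<^sup>2 - d\<^sup>2 < e\<^sup>2 / 4"
      by (auto simp: eventually_sequentially)
    have "dist (s m) (s n) < e" if "m \<ge> N" "n \<ge> N" for m n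
      using par[OF s(1)[of m] s(1)[of n]] N[OF that(1)] N[OF that(2)] \<open>e > 0\<close>
      by (intro power2_less_imp_less[of _ e]) auto
    then show "\<exists>M. \<forall>m\<ge>M. \<forall>n\<ge>M. dist (s m) (s n) < e" by blast
  qed
  then obtain x where x: "s \<longlonglongrightarrow> x"
    by (auto simp: convergent_eq_Cauchy[symmetric])
  have "x \<in> X"
    using closed_sequentially[OF assms(1)] s(1) x by blast
  have "dist a x = d"
    using LIMSEQ_unique[OF tendsto_dist[OF tendsto_const x] lim] .
  show ?thesis
  proof (rule ex1I[of _ x])
    show "x \<in> X \<and> (\<forall>y\<in>X. dist a x \<le> dist a y)"
      using \<open>x \<in> X\<close> \<open>dist a x = d\<close> d_le by simp
  next
    fix y assume y: "y \<in> X \<and> (\<forall>z\<in>X. dist a y \<le> dist a z)"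
    then have "dist a y = d"
      using \<open>x \<in> X\<close> \<open>dist a x = d\<close> d_le by (metis order_antisym)
    then have "(dist y x)\<^sup>2 \<le> 0"
      using par[of y x] y \<open>x \<in> X\<close> \<open>dist a x = d\<close> by simp
    then show "y = x" by simp
  qed
qed

lemma
  fixes X :: "'h::{real_inner, complete_space} set"
  assumes "closed X" "convex X" "X \<noteq> {}"
  shows proj_in: "proj X a \<in> X"
    and proj_le: "y \<in> X \<Longrightarrow> dist a (proj X a) \<le> dist a y"
  using theI'[OF proj_unique_exists[OF assms, of a]] unfolding proj_def by auto

lemma proj_inner_le:
  fixes X :: "'h::{real_inner, complete_space} set"
  assumes "closed X" "convex X" "X \<noteq> {}" "y \<in> X"
  shows "inner (a - proj X a) (y - proj X a) \<le> 0"
  using any_closest_point_dot[OF assms(2,1) proj_in assms(4)] proj_le assms by blast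

lemma proj_nonexpansive:
  fixes X :: "'h::{real_inner, complete_space} set"
  assumes "closed X" "convex X" "X \<noteq> {}"
  shows "dist (proj X a) (proj X b) \<le> dist a b"
proof -
  have "inner (a - proj X a) (proj X b - proj X a) \<le> 0" "inner (b - proj X b) (proj X a - proj X b) \<le> 0"
    using proj_inner_le proj_in assms by blast+
  then have "(norm (proj X a - proj X b))\<^sup>2 \<le> inner (a - b) (proj X a - proj X b)"
    by (simp add: power2_norm_eq_inner inner_diff inner_commute algebra_simps)
  also have "\<dots> \<le> norm (a - b) * norm (proj X a - proj X b)"
    by (rule norm_cauchy_schwarz)
  finally show ?thesis
    by (cases "proj X a = proj X b") (auto simp: power2_eq_square dist_norm)
qed

lemma proj_self:
  fixes X :: "'h::{real_inner, complete_space} set"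
  assumes "closed X" "convex X" "y \<in> X"
  shows "proj X y = y"
  using proj_le[OF assms(1,2) _ assms(3), of y] assms(3) by fastforce

text \<open>The codomain is the subspace \<open>X\<close> with its trace sigma-algebra, because the
  oracle is jointly measurable only there; iterates must be random elements of that space to be
  inserted into it.\<close>

lemma proj_borel_measurable:
  fixes X :: "'h::{real_inner, complete_space} set"
  assumes "closed X" "convex X" "X \<noteq> {}"
  shows "proj X \<in> borel \<rightarrow>\<^sub>M restrict_space borel X"
proof (rule measurable_restrict_space2)
  have "1-lipschitz_on UNIV (proj X)"
    using proj_nonexpansive[OF assms] by (auto intro!: lipschitz_onI)
  then show "proj X \<in> borel_measurable borel"
    by (intro borel_measurable_continuous_onI lipschitz_on_continuous_on)
qed (use proj_in[OF assms] in auto)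

section \<open>Bias and second moment of clipped vectors\<close>

text \<open>Midpoint convexity of the \<open>p\<close>-th power, used on the positive half-line,
  with zero arguments treated apart. The factor \<open>2 powr (p - 1)\<close> of \<open>bp\<close>
  originates here.\<close>

lemma add_powr_le:
  fixes s t p :: real
  assumes "s \<ge> 0" "t \<ge> 0" "p \<ge> 1"
  shows "(s + t) powr p \<le> 2 powr (p - 1) * (s powr p + t powr p)"
proof (cases "s = 0 \<or> t = 0")
  case True
  moreover have "r powr p \<le> 2 powr (p - 1) * r powr p" for r
    using assms mult_right_mono[of 1 "2 powr (p - 1)" "r powr p"] by (simp add: ge_one_powr_ge_zero)
  ultimately show ?thesis using assms by auto
next
  case False
  then have "s > 0" "t > 0" using assms by auto
  have "((1/2) * s + (1/2) * t) powr p \<le> (1/2) * s powr p + (1/2) * t powr p"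
    using convex_onD[OF powr_convex[OF assms(3)], of "1/2" s t] \<open>s > 0\<close> \<open>t > 0\<close> by simp
  moreover have "((1/2) * s + (1/2) * t) powr p = (s + t) powr p / 2 powr p"
    using assms by (simp add: powr_divide flip: add_divide_distrib)
  ultimately show ?thesis
    using assms by (simp add: powr_diff powr_divide field_simps)
qed

lemma clip_eq_self: "l > 0 \<Longrightarrow> norm v \<le> l \<Longrightarrow> clip v l = v"
  by (simp add: clip_def max_def)

lemma clip_outside: "l > 0 \<Longrightarrow> norm v > l \<Longrightarrow> clip v l = (l / norm v) *\<^sub>R v"
  by (simp add: clip_def max_def)

lemma norm_clip: "l > 0 \<Longrightarrow> norm (clip v l) = min (norm v) l"
  by (cases "norm v \<le> l") (auto simp: clip_eq_self clip_outside)

lemma norm_diff_clip: "l > 0 \<Longrightarrow> norm (v - clip v l) = max 0 (norm v - l)"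
proof (cases "norm v \<le> l")
  case False
  assume "l > 0"
  have "v - clip v l = (1 - l / norm v) *\<^sub>R v"
    using False \<open>l > 0\<close> by (simp add: clip_outside scaleR_diff_left)
  also have "norm \<dots> = (1 - l / norm v) * norm v"
    using False \<open>l > 0\<close> by (simp add: divide_le_eq_1)
  also have "\<dots> = norm v - l"
    using False \<open>l > 0\<close> by (cases "v = 0") (auto simp: field_simps)
  finally show ?thesis
    using False by simp
qed (simp add: clip_eq_self)

lemma clip_borel_measurable [measurable]:
  "(\<lambda>v::'h::{real_normed_vector, second_countable_topology}. clip v l) \<in> borel_measurable borel"
  unfolding clip_def by measurable

text \<open>Clipping changes \<open>v\<close> only if its norm exceeds \<open>l\<close>, and then
  \<open>v\<close> is at distance t > l - L from \<open>g\<close>, while the error is at most t. As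
  t is at least the threshold \<open>d\<close>, the factor (t / d)^(p-1) is at least 1 and turns t
  into a multiple of t^p. The bound is pointwise, so a \<open>p\<close>-th moment of the noise
  suffices later.\<close>

lemma clip_error_le:
  fixes v g :: "'h::real_normed_vector"
  assumes "\<epsilon> > 0" "L > 0" "l \<ge> (1 + \<epsilon>) * L" "norm g \<le> L" "p > 1"
  shows "norm (v - clip v l) \<le> ((1 + 1 / \<epsilon>) / l) powr (p - 1) * norm (v - g) powr p"
proof -
  have "(1 + \<epsilon>) * L > L" using assms by simp
  then have l: "l > L" "l > 0" using assms by linarith+
  \<comment> \<open>Since \<open>l - d = l / (1 + \<epsilon>)\<close>, the hypothesis
    \<open>l \<ge> (1 + \<epsilon>) * L\<close> amounts to \<open>d \<le> l - L\<close>.\<close>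
  define d where "d = l / (1 + 1 / \<epsilon>)"
  have d: "0 < d" "d \<le> l - L"
  proof -
    show "0 < d" using assms l by (simp add: d_def add_pos_pos)
    have "d = l * \<epsilon> / (1 + \<epsilon>)" using assms by (simp add: d_def field_simps)
    moreover have "\<dots> \<le> l - L" using assms by (simp add: field_simps)
    ultimately show "d \<le> l - L" by simp
  qed
  show ?thesis
  proof (cases "norm v \<le> l")
    case True
    then show ?thesis using l by (simp add: clip_eq_self)
  next
    case False
    define t where "t = norm (v - g)"
    have "norm v \<le> t + L"
      using norm_triangle_sub[of v g] assms by (simp add: t_def)
    then have t: "t \<ge> d" "t > 0" "norm v - l \<le> t"
      using False d l by linarith+
    have "norm (v - clip v l) \<le> t"
      using t False l by (simp add: norm_diff_clip)
    also have "\<dots> = (1 / t) powr (p - 1) * t powr p"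
      using t by (simp add: powr_divide powr_diff)
    also have "\<dots> \<le> (1 / d) powr (p - 1) * t powr p"
      using t d assms by (intro mult_right_mono powr_mono2) (auto simp: frac_le)
    finally show ?thesis by (simp add: d_def t_def)
  qed
qed

text \<open>The square of the clipped norm c is split as c^(2-p) c^p: the first factor is bounded by
  the clipping level, the second by the unclipped norm, which has a finite \<open>p\<close>-th
  moment.\<close>

lemma clip_second_moment_le:
  fixes v g :: "'h::real_normed_vector"
  assumes "l > 0" "norm g \<le> L" "1 < p" "p \<le> 2"
  shows "(norm (clip v l))\<^sup>2 \<le> l powr (2 - p) * (2 powr (p - 1) * (norm (v - g) powr p + L powr p))"
proof (cases "v = 0")
  case False
  define c where "c = norm (clip v l)"
  have c: "c > 0" "c \<le> l" "c \<le> norm v" using False assms by (auto simp: c_def norm_clip)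
  have "c\<^sup>2 = c powr (2 - p) * c powr p"
    using c by (simp flip: powr_add powr_numeral)
  also have "\<dots> \<le> l powr (2 - p) * (norm (v - g) + L) powr p"
    using c assms norm_triangle_sub[of v g] by (intro mult_mono powr_mono2) auto
  also have "\<dots> \<le> l powr (2 - p) * (2 powr (p - 1) * (norm (v - g) powr p + L powr p))"
    using assms order_trans[OF norm_ge_zero assms(2)] by (intro mult_left_mono add_powr_le) auto
  finally show ?thesis by (simp add: c_def)
qed (simp add: clip_def)

text \<open>Testing the subgradient at \<open>y + g\<close> gives growth of at least the squared
  norm of \<open>g\<close>, whereas the Lipschitz condition allows at most \<open>L\<close> times
  the norm.\<close>

lemma norm_subgradient_le:
  fixes f :: "'h::real_inner \<Rightarrow> real"
  assumes "L-lipschitz_on UNIV f" "g \<in> subdifferential f y"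
  shows "norm g \<le> L"
proof -
  have "f (y + g) \<ge> f y + (norm g)\<^sup>2"
    using assms(2) by (auto simp: subdifferential_def power2_norm_eq_inner dest: spec[of _ "y + g"])
  moreover have "\<bar>f (y + g) - f y\<bar> \<le> L * norm g"
    using lipschitz_onD[OF assms(1), of "y + g" y] by (simp add: dist_norm)
  ultimately have "norm g * norm g \<le> L * norm g"
    by (simp add: power2_eq_square)
  then show ?thesis
    using lipschitz_on_nonneg[OF assms(1)] by (cases "g = 0") auto
qed

subsection \<open>One clipped subgradient step in expectation\<close>

text \<open>After expanding the square, the clipped vector in the linear term is replaced by
  \<open>V s\<close>, whose mean is a subgradient. The replacement error and the squared clipped
  norm are bounded pointwise by multiples of the \<open>p\<close>-th power of the noise, up to
  \<open>L powr p\<close>, and then integrated.\<close>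

lemma clipped_step_expectation:
  fixes f :: "'h::{real_inner, banach, second_countable_topology} \<Rightarrow> real"
    and V :: "'s \<Rightarrow> 'h"
  assumes Q: "prob_space Q"
    and V: "integrable Q V" "(\<integral>s. V s \<partial>Q) \<in> subdifferential f y"
    and noise: "(\<integral>\<^sup>+s. ennreal (norm (V s - (\<integral>s. V s \<partial>Q)) powr p) \<partial>Q) \<le> ennreal (\<sigma> powr p)"
    and f: "L-lipschitz_on UNIV f" "L > 0"
    and X: "closed X" "convex X" "z \<in> X"
    and par: "1 < p" "p \<le> 2" "\<epsilon> > 0" "l \<ge> (1 + \<epsilon>) * L" "\<eta> > 0"
  shows "(\<integral>s. (norm (proj X (y - \<eta> *\<^sub>R clip (V s) l) - z))\<^sup>2 \<partial>Q) \<le>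
    (norm (y - z))\<^sup>2 - 2 * \<eta> * (f y - f z)
    + 2 * \<eta> * (((1 + 1 / \<epsilon>) / l) powr (p - 1) * \<sigma> powr p) * norm (y - z)
    + \<eta>\<^sup>2 * (l powr (2 - p) * (2 powr (p - 1) * (\<sigma> powr p + L powr p)))"
proof -
  interpret Q: prob_space Q by fact
  have X_ne: "X \<noteq> {}" using X by auto
  have [measurable]: "proj X \<in> borel_measurable borel"
    using proj_borel_measurable[OF X(1,2) X_ne] by (simp add: measurable_restrict_space2_iff)
  have [measurable]: "V \<in> borel_measurable Q" using V(1) by simp
  define g where "g = (\<integral>s. V s \<partial>Q)"
  define N where "N s = norm (V s - g) powr p" for s
  have g: "norm g \<le> L"
    using norm_subgradient_le[OF f(1) V(2)] by (simp add: g_def)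
  have [measurable]: "N \<in> borel_measurable Q"
    unfolding N_def by measurable
  have N_bound: "(\<integral>\<^sup>+s. ennreal (N s) \<partial>Q) \<le> ennreal (\<sigma> powr p)"
    using noise by (simp add: N_def g_def)
  have N_int: "integrable Q N"
    using N_bound by (intro integrableI_nonneg) (auto simp: N_def intro: le_less_trans)
  have N_le: "(\<integral>s. N s \<partial>Q) \<le> \<sigma> powr p"
    using N_bound by (subst (asm) nn_integral_eq_integral[OF N_int]) (simp_all add: N_def[abs_def])
  have "L < (1 + \<epsilon>) * L" using f par by simp
  then have l: "l > 0" using f par by linarith
  define P where "P s = proj X (y - \<eta> *\<^sub>R clip (V s) l)" for s
  define c1 where "c1 = ((1 + 1 / \<epsilon>) / l) powr (p - 1)"
  define c2 where "c2 = l powr (2 - p) * 2 powr (p - 1)"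
  have c_nonneg: "c1 \<ge> 0" "c2 \<ge> 0" by (simp_all add: c1_def c2_def)
  have P_le: "norm (P s - z) \<le> norm (y - \<eta> *\<^sub>R clip (V s) l - z)" for s
    using proj_nonexpansive[OF X(1,2) X_ne, of "y - \<eta> *\<^sub>R clip (V s) l" z] proj_self[OF X]
    by (simp add: P_def dist_norm)
  \<comment> \<open>\<open>V\<close> need not have a second moment, but clipping limits the step to
    length \<open>\<eta> * l\<close>, so the squared distance is bounded.\<close>
  have P_int: "integrable Q (\<lambda>s. (norm (P s - z))\<^sup>2)"
  proof (rule Q.integrable_const_bound)
    show "AE s in Q. norm ((norm (P s - z))\<^sup>2) \<le> (norm (y - z) + \<eta> * l)\<^sup>2"
    proof (rule AE_I2)
      fix s
      have "norm (P s - z) \<le> norm ((y - z) - \<eta> *\<^sub>R clip (V s) l)"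
        using P_le[of s] by (simp add: algebra_simps)
      also have "\<dots> \<le> norm (y - z) + \<eta> * norm (clip (V s) l)"
        using norm_triangle_ineq4[of "y - z" "\<eta> *\<^sub>R clip (V s) l"] par by simp
      also have "\<dots> \<le> norm (y - z) + \<eta> * l"
        using par l by (simp add: norm_clip)
      finally show "norm ((norm (P s - z))\<^sup>2) \<le> (norm (y - z) + \<eta> * l)\<^sup>2"
        by (simp add: power_mono)
    qed
    show "(\<lambda>s. (norm (P s - z))\<^sup>2) \<in> borel_measurable Q" unfolding P_def by measurable
  qed
  have pointwise: "(norm (P s - z))\<^sup>2 \<le> (norm (y - z))\<^sup>2 - 2 * \<eta> * inner (V s) (y - z)
      + 2 * \<eta> * (c1 * N s) * norm (y - z) + \<eta>\<^sup>2 * (c2 * (N s + L powr p))" for s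
  proof -
    define T where "T = clip (V s) l"
    have "(norm (P s - z))\<^sup>2 \<le> (norm (y - \<eta> *\<^sub>R T - z))\<^sup>2"
      using P_le[of s] by (simp add: power_mono T_def)
    also have "\<dots> = (norm (y - z))\<^sup>2 - 2 * \<eta> * inner T (y - z) + \<eta>\<^sup>2 * (norm T)\<^sup>2"
      unfolding power2_norm_eq_inner
      by (simp add: inner_diff_left inner_diff_right inner_commute algebra_simps power2_eq_square)
    also have "\<dots> = (norm (y - z))\<^sup>2 - 2 * \<eta> * inner (V s) (y - z)
        + 2 * \<eta> * inner (V s - T) (y - z) + \<eta>\<^sup>2 * (norm T)\<^sup>2"
      by (simp add: inner_diff_left algebra_simps)
    also have "\<dots> \<le> (norm (y - z))\<^sup>2 - 2 * \<eta> * inner (V s) (y - z)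
        + 2 * \<eta> * (c1 * N s * norm (y - z)) + \<eta>\<^sup>2 * (c2 * (N s + L powr p))"
    proof (intro add_mono mult_left_mono order_refl)
      have "inner (V s - T) (y - z) \<le> norm (V s - T) * norm (y - z)"
        by (rule norm_cauchy_schwarz)
      also have "\<dots> \<le> c1 * N s * norm (y - z)"
        unfolding T_def c1_def N_def using par f g
        by (intro mult_right_mono clip_error_le[of \<epsilon> L]) auto
      finally show "inner (V s - T) (y - z) \<le> c1 * N s * norm (y - z)" .
      show "(norm T)\<^sup>2 \<le> c2 * (N s + L powr p)"
        using clip_second_moment_le[OF l g par(1,2), of "V s"]
        by (simp add: T_def c2_def N_def mult.assoc)
    qed (use par in auto)
    finally show ?thesis by (simp add: mult.assoc)
  qed
  have "(\<integral>s. (norm (P s - z))\<^sup>2 \<partial>Q) \<le> (\<integral>s. (norm (y - z))\<^sup>2 - 2 * \<eta> * inner (V s) (y - z)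
      + 2 * \<eta> * (c1 * N s) * norm (y - z) + \<eta>\<^sup>2 * (c2 * (N s + L powr p)) \<partial>Q)"
    by (intro integral_mono P_int pointwise) (use V(1) N_int in simp)
  also have "\<dots> = (norm (y - z))\<^sup>2 - 2 * \<eta> * inner g (y - z)
      + 2 * \<eta> * (c1 * (\<integral>s. N s \<partial>Q)) * norm (y - z) + \<eta>\<^sup>2 * (c2 * ((\<integral>s. N s \<partial>Q) + L powr p))"
    using V(1) N_int by (simp add: g_def Q.prob_space integral_inner_left)
  also have "\<dots> \<le> (norm (y - z))\<^sup>2 - 2 * \<eta> * (f y - f z)
      + 2 * \<eta> * (c1 * \<sigma> powr p) * norm (y - z) + \<eta>\<^sup>2 * (c2 * (\<sigma> powr p + L powr p))"
  proof (intro add_mono diff_mono mult_left_mono mult_right_mono order_refl)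
    show "f y - f z \<le> inner g (y - z)"
      using V(2) by (auto simp: subdifferential_def g_def inner_diff_right dest!: spec[of _ z])
  qed (use par c_nonneg N_le in auto)
  finally show ?thesis by (simp add: P_def c1_def c2_def mult.assoc)
qed

text \<open>Fubini: under the product law the inner integral over the batch is the case of fixed
  points. \<open>Z\<close> is random because iterates will serve as reference points. The sure bound
  \<open>R\<close> supplies integrability and does not enter the estimate.\<close>

lemma (in prob_space) clipped_step_expectation_random:
  fixes f :: "'h::{real_inner, banach, second_countable_topology} \<Rightarrow> real"
    and U :: "'h \<Rightarrow> 's \<Rightarrow> 'h" and X :: "'h set"
  defines "BX \<equiv> restrict_space borel X"
  assumes YZ [measurable]: "(\<lambda>\<omega>. (Y \<omega>, Z \<omega>)) \<in> M \<rightarrow>\<^sub>M BX \<Otimes>\<^sub>M BX" and T [measurable]: "T \<in> M \<rightarrow>\<^sub>M N"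
    and indep: "distr M (BX \<Otimes>\<^sub>M BX) (\<lambda>\<omega>. (Y \<omega>, Z \<omega>)) \<Otimes>\<^sub>M distr M N T =
      distr M ((BX \<Otimes>\<^sub>M BX) \<Otimes>\<^sub>M N) (\<lambda>\<omega>. ((Y \<omega>, Z \<omega>), T \<omega>))"
    and U: "(\<lambda>(y, s). U y s) \<in> BX \<Otimes>\<^sub>M N \<rightarrow>\<^sub>M borel"
    and U_integrable: "\<And>y. y \<in> X \<Longrightarrow> integrable (distr M N T) (U y)"
    and U_subgradient: "\<And>y. y \<in> X \<Longrightarrow> (\<integral>s. U y s \<partial>distr M N T) \<in> subdifferential f y"
    and noise: "\<And>y. y \<in> X \<Longrightarrow>
      (\<integral>\<^sup>+s. ennreal (norm (U y s - (\<integral>s. U y s \<partial>distr M N T)) powr p) \<partial>distr M N T)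
        \<le> ennreal (\<sigma> powr p)"
    and f: "L-lipschitz_on UNIV f" "L > 0"
    and X: "closed X" "convex X"
    and par: "1 < p" "p \<le> 2" "\<epsilon> > 0" "l \<ge> (1 + \<epsilon>) * L" "\<eta> > 0"
    and bounded: "\<And>\<omega>. \<omega> \<in> space M \<Longrightarrow> norm (Y \<omega> - Z \<omega>) \<le> R"
  shows "expectation (\<lambda>\<omega>. (norm (proj X (Y \<omega> - \<eta> *\<^sub>R clip (U (Y \<omega>) (T \<omega>)) l) - Z \<omega>))\<^sup>2) \<le>
    expectation (\<lambda>\<omega>. (norm (Y \<omega> - Z \<omega>))\<^sup>2) - 2 * \<eta> * expectation (\<lambda>\<omega>. f (Y \<omega>) - f (Z \<omega>))
    + 2 * \<eta> * (((1 + 1 / \<epsilon>) / l) powr (p - 1) * \<sigma> powr p) * expectation (\<lambda>\<omega>. norm (Y \<omega> - Z \<omega>))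
    + \<eta>\<^sup>2 * (l powr (2 - p) * (2 powr (p - 1) * (\<sigma> powr p + L powr p)))"
proof -
  define \<phi> where "\<phi> w s = (norm (proj X (fst w - \<eta> *\<^sub>R clip (U (fst w) s) l) - snd w))\<^sup>2" for w s
  define \<psi> where "\<psi> w = (norm (fst w - snd w))\<^sup>2 - 2 * \<eta> * (f (fst w) - f (snd w))
    + 2 * \<eta> * (((1 + 1 / \<epsilon>) / l) powr (p - 1) * \<sigma> powr p) * norm (fst w - snd w)
    + \<eta>\<^sup>2 * (l powr (2 - p) * (2 powr (p - 1) * (\<sigma> powr p + L powr p)))" for w
  have YX: "Y \<omega> \<in> X" "Z \<omega> \<in> X" if "\<omega> \<in> space M" for \<omega>
    using measurable_space[OF YZ that] by (auto simp: space_pair_measure BX_def space_restrict_space)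
  obtain \<omega>0 where "\<omega>0 \<in> space M" using not_empty by blast
  then have X_ne: "X \<noteq> {}" using YX by auto
  have "L < (1 + \<epsilon>) * L" using f par by simp
  then have l: "l > 0" using f par by linarith
  have [measurable]: "proj X \<in> borel_measurable borel"
    using proj_borel_measurable[OF X X_ne] by (simp add: measurable_restrict_space2_iff)
  have [measurable]: "f \<in> borel_measurable borel"
    using f by (intro borel_measurable_continuous_onI lipschitz_on_continuous_on)
  have [measurable]: "(\<lambda>y. y) \<in> BX \<rightarrow>\<^sub>M borel"
    by (simp add: BX_def measurable_restrict_space1)
  have fst_B [measurable]: "fst \<in> BX \<Otimes>\<^sub>M BX \<rightarrow>\<^sub>M borel" and snd_B [measurable]: "snd \<in> BX \<Otimes>\<^sub>M BX \<rightarrow>\<^sub>M borel"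
    using measurable_compose[OF measurable_fst \<open>(\<lambda>y. y) \<in> BX \<rightarrow>\<^sub>M borel\<close>]
      measurable_compose[OF measurable_snd \<open>(\<lambda>y. y) \<in> BX \<rightarrow>\<^sub>M borel\<close>] by auto
  have [measurable]: "Y \<in> borel_measurable M" "Z \<in> borel_measurable M"
    using measurable_compose[OF YZ fst_B] measurable_compose[OF YZ snd_B] by auto
  have U1: "(\<lambda>w. U (fst (fst w)) (snd w)) \<in> borel_measurable ((BX \<Otimes>\<^sub>M BX) \<Otimes>\<^sub>M N)"
    using measurable_compose[OF _ U, of "\<lambda>w. (fst (fst w), snd w)" "(BX \<Otimes>\<^sub>M BX) \<Otimes>\<^sub>M N"] by simp
  have fst_fst: "(\<lambda>w. fst (fst w)) \<in> borel_measurable ((BX \<Otimes>\<^sub>M BX) \<Otimes>\<^sub>M N)"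
    and snd_fst: "(\<lambda>w. snd (fst w)) \<in> borel_measurable ((BX \<Otimes>\<^sub>M BX) \<Otimes>\<^sub>M N)"
    using measurable_compose[OF measurable_fst fst_B] measurable_compose[OF measurable_fst snd_B] by auto
  have \<phi>_meas: "(\<lambda>(w, s). \<phi> w s) \<in> borel_measurable ((BX \<Otimes>\<^sub>M BX) \<Otimes>\<^sub>M N)"
  proof -
    note [measurable] = U1 fst_fst snd_fst
    show ?thesis unfolding \<phi>_def case_prod_beta by measurable
  qed
  have \<psi>_meas: "\<psi> \<in> borel_measurable (BX \<Otimes>\<^sub>M BX)"
    unfolding \<psi>_def by measurable
  define D where "D = distr M (BX \<Otimes>\<^sub>M BX) (\<lambda>\<omega>. (Y \<omega>, Z \<omega>))"
  define Q where "Q = distr M N T"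
  interpret D: prob_space D unfolding D_def by (rule prob_space_distr) fact
  interpret Q: prob_space Q unfolding Q_def by (rule prob_space_distr) fact
  interpret DQ: pair_prob_space D Q ..
  have DQ: "D \<Otimes>\<^sub>M Q = distr M ((BX \<Otimes>\<^sub>M BX) \<Otimes>\<^sub>M N) (\<lambda>\<omega>. ((Y \<omega>, Z \<omega>), T \<omega>))"
    using indep unfolding D_def Q_def .
  have joint: "(\<lambda>\<omega>. ((Y \<omega>, Z \<omega>), T \<omega>)) \<in> M \<rightarrow>\<^sub>M (BX \<Otimes>\<^sub>M BX) \<Otimes>\<^sub>M N"
    by measurable
  have norm_YZ: "integrable M (\<lambda>\<omega>. norm (Y \<omega> - Z \<omega>))"
    using bounded by (intro integrable_const_bound[of _ R]) auto
  have norm2_YZ: "integrable M (\<lambda>\<omega>. (norm (Y \<omega> - Z \<omega>))\<^sup>2)"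
    using bounded by (intro integrable_const_bound[of _ "R\<^sup>2"]) (auto intro!: power_mono)
  have f_YZ: "integrable M (\<lambda>\<omega>. f (Y \<omega>) - f (Z \<omega>))"
  proof (rule integrable_const_bound[of _ "L * R"])
    show "AE \<omega> in M. norm (f (Y \<omega>) - f (Z \<omega>)) \<le> L * R"
    proof (rule AE_I2)
      fix \<omega> assume "\<omega> \<in> space M"
      then have "L * norm (Y \<omega> - Z \<omega>) \<le> L * R"
        using bounded f(2) by simp
      then show "norm (f (Y \<omega>) - f (Z \<omega>)) \<le> L * R"
        using lipschitz_onD[OF f(1), of "Y \<omega>" "Z \<omega>"] by (simp add: dist_norm)
    qed
  qed measurable
  have \<psi>_int: "integrable M (\<lambda>\<omega>. \<psi> (Y \<omega>, Z \<omega>))"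
    unfolding \<psi>_def using norm_YZ norm2_YZ f_YZ by simp
  have \<phi>_int: "integrable M (\<lambda>\<omega>. \<phi> (Y \<omega>, Z \<omega>) (T \<omega>))"
  proof (rule integrable_const_bound[of _ "(R + \<eta> * l)\<^sup>2"])
    show "AE \<omega> in M. norm (\<phi> (Y \<omega>, Z \<omega>) (T \<omega>)) \<le> (R + \<eta> * l)\<^sup>2"
    proof (rule AE_I2)
      fix \<omega> assume \<omega>: "\<omega> \<in> space M"
      define v where "v = clip (U (Y \<omega>) (T \<omega>)) l"
      have "norm (proj X (Y \<omega> - \<eta> *\<^sub>R v) - Z \<omega>) \<le> norm ((Y \<omega> - Z \<omega>) - \<eta> *\<^sub>R v)"
        using proj_nonexpansive[OF X X_ne, of "Y \<omega> - \<eta> *\<^sub>R v" "Z \<omega>"] proj_self[OF X YX(2)[OF \<omega>]]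
        by (simp add: dist_norm algebra_simps)
      also have "\<dots> \<le> norm (Y \<omega> - Z \<omega>) + \<eta> * norm v"
        using norm_triangle_ineq4[of "Y \<omega> - Z \<omega>" "\<eta> *\<^sub>R v"] par by simp
      also have "\<dots> \<le> R + \<eta> * l"
        using bounded[OF \<omega>] par l by (intro add_mono mult_left_mono) (auto simp: v_def norm_clip)
      finally show "norm (\<phi> (Y \<omega>, Z \<omega>) (T \<omega>)) \<le> (R + \<eta> * l)\<^sup>2"
        by (simp add: \<phi>_def v_def power_mono)
    qed
    show "(\<lambda>\<omega>. \<phi> (Y \<omega>, Z \<omega>) (T \<omega>)) \<in> borel_measurable M"
      using measurable_compose[OF joint \<phi>_meas] by simp
  qed
  have \<phi>_int': "integrable (D \<Otimes>\<^sub>M Q) (\<lambda>(w, s). \<phi> w s)"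
    unfolding DQ using \<phi>_int by (subst integrable_distr_eq[OF joint \<phi>_meas]) simp
  have "expectation (\<lambda>\<omega>. \<phi> (Y \<omega>, Z \<omega>) (T \<omega>)) = (\<integral>w. case_prod \<phi> w \<partial>(D \<Otimes>\<^sub>M Q))"
    unfolding DQ by (subst integral_distr[OF joint \<phi>_meas]) simp
  also have "\<dots> = (\<integral>w. \<integral>s. \<phi> w s \<partial>Q \<partial>D)"
    by (rule DQ.integral_fst[OF \<phi>_int', symmetric])
  also have "\<dots> \<le> (\<integral>w. \<psi> w \<partial>D)"
  proof (rule integral_mono)
    show "integrable D (\<lambda>w. \<integral>s. \<phi> w s \<partial>Q)"
      by (rule DQ.integrable_fst[OF \<phi>_int'])
    show "integrable D \<psi>"
      unfolding D_def using \<psi>_int by (subst integrable_distr_eq[OF YZ \<psi>_meas])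
    fix w assume "w \<in> space D"
    then have "fst w \<in> X" "snd w \<in> X"
      by (auto simp: D_def space_pair_measure BX_def space_restrict_space)
    then show "(\<integral>s. \<phi> w s \<partial>Q) \<le> \<psi> w"
      unfolding \<phi>_def \<psi>_def Q_def
      by (intro clipped_step_expectation prob_space_distr T U_integrable U_subgradient noise f X par)
  qed
  also have "\<dots> = expectation (\<lambda>\<omega>. \<psi> (Y \<omega>, Z \<omega>))"
    unfolding D_def by (rule integral_distr[OF YZ \<psi>_meas])
  also have "\<dots> = expectation (\<lambda>\<omega>. (norm (Y \<omega> - Z \<omega>))\<^sup>2) - 2 * \<eta> * expectation (\<lambda>\<omega>. f (Y \<omega>) - f (Z \<omega>))
    + 2 * \<eta> * (((1 + 1 / \<epsilon>) / l) powr (p - 1) * \<sigma> powr p) * expectation (\<lambda>\<omega>. norm (Y \<omega> - Z \<omega>))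
    + \<eta>\<^sup>2 * (l powr (2 - p) * (2 powr (p - 1) * (\<sigma> powr p + L powr p)))"
    unfolding \<psi>_def fst_conv snd_conv using norm_YZ norm2_YZ f_YZ
    by (subst Bochner_Integration.integral_add Bochner_Integration.integral_diff; simp add: prob_space)+
  finally show ?thesis by (simp add: \<phi>_def)
qed

section \<open>Independence of the history and the next batch\<close>

text \<open>\<^const>\<open>prob_space.indep_var\<close> forces both variables to take values in the same type, so independence
  of the history and the next batch is stated as a product law.\<close>

lemma (in prob_space) distr_history_pair:
  assumes indep: "indep_vars (\<lambda>_. N) B I" and J: "J \<subseteq> I" "i \<in> I" "i \<notin> J"
    and F: "F \<in> PiM J (\<lambda>_. N) \<rightarrow>\<^sub>M K"
    and W: "\<And>\<omega>. \<omega> \<in> space M \<Longrightarrow> W \<omega> = F (\<lambda>j\<in>J. B j \<omega>)"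
  shows "distr M K W \<Otimes>\<^sub>M distr M N (B i) = distr M (K \<Otimes>\<^sub>M N) (\<lambda>\<omega>. (W \<omega>, B i \<omega>))"
proof -
  let ?H = "PiM J (\<lambda>_. N)" and ?S = "PiM {i} (\<lambda>_. N)"
  let ?h = "\<lambda>\<omega>. \<lambda>j\<in>J. B j \<omega>" and ?s = "\<lambda>\<omega>. \<lambda>j\<in>{i}. B j \<omega>"
  \<comment> \<open>The next batch is viewed as a family over the singleton \<open>{i}\<close>, so
    that independence over disjoint index sets applies. \<open>F\<close> and evaluation at
    \<open>i\<close> are then pushed through the product law.\<close>
  have iv: "indep_var ?H ?h ?S ?s"
    using J by (intro indep_var_restrict[OF indep]) auto
  then have h: "?h \<in> M \<rightarrow>\<^sub>M ?H" and s: "?s \<in> M \<rightarrow>\<^sub>M ?S"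
    using indep_var_rv1 indep_var_rv2 by blast+
  have comp: "(\<lambda>b. b i) \<in> ?S \<rightarrow>\<^sub>M N"
    by (intro measurable_component_singleton) auto
  have B: "B i \<in> M \<rightarrow>\<^sub>M N"
    using indep J by (auto simp: indep_vars_def)
  have "distr M K W = distr (distr M ?H ?h) K F"
    using W by (subst distr_distr[OF F h]) (auto intro: distr_cong)
  moreover have "distr M N (B i) = distr (distr M ?S ?s) N (\<lambda>b. b i)"
    by (subst distr_distr[OF comp s]) (auto intro: distr_cong)
  moreover have "distr (distr M ?H ?h) K F \<Otimes>\<^sub>M distr (distr M ?S ?s) N (\<lambda>b. b i) =
      distr (distr M ?H ?h \<Otimes>\<^sub>M distr M ?S ?s) (K \<Otimes>\<^sub>M N) (\<lambda>(b, c). (F b, c i))"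
  proof (rule pair_measure_distr)
    show "sigma_finite_measure (distr (distr M ?S ?s) N (\<lambda>b. b i))"
      by (intro prob_space_imp_sigma_finite prob_space.prob_space_distr prob_space_distr s)
        (use comp in simp)
  qed (use F comp in auto)
  moreover have "distr M ?H ?h \<Otimes>\<^sub>M distr M ?S ?s = distr M (?H \<Otimes>\<^sub>M ?S) (\<lambda>\<omega>. (?h \<omega>, ?s \<omega>))"
    using iv unfolding indep_var_distribution_eq by blast
  moreover have "distr (distr M (?H \<Otimes>\<^sub>M ?S) (\<lambda>\<omega>. (?h \<omega>, ?s \<omega>))) (K \<Otimes>\<^sub>M N) (\<lambda>(b, c). (F b, c i)) =
      distr M (K \<Otimes>\<^sub>M N) (\<lambda>\<omega>. (W \<omega>, B i \<omega>))"
  proof -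
    have "(\<lambda>(b, c). (F b, c i)) \<in> ?H \<Otimes>\<^sub>M ?S \<rightarrow>\<^sub>M K \<Otimes>\<^sub>M N"
      using F comp by measurable
    then show ?thesis
      using W by (subst distr_distr[OF _ measurable_Pair[OF h s]]) (auto intro!: distr_cong)
  qed
  ultimately show ?thesis by simp
qed

text \<open>An explicit factorisation in place of a filtration: the recursion is unrolled into a
  measurable function of the batches before \<open>i\<close>. Index \<open>i\<close> itself is
  excluded, which is what makes the iterate independent of batch \<open>i\<close>.\<close>

lemma iterate_measurable_history:
  fixes x :: "nat \<Rightarrow> 'w \<Rightarrow> 'h::{real_inner, banach, second_countable_topology}"
  assumes X: "closed X" "convex X" "x1 \<in> X"
    and U: "(\<lambda>(y, s). U y s) \<in> restrict_space borel X \<Otimes>\<^sub>M N \<rightarrow>\<^sub>M borel"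
    and init: "\<And>\<omega>. \<omega> \<in> \<Omega> \<Longrightarrow> x 1 \<omega> = x1"
    and step: "\<And>i \<omega>. i \<ge> 1 \<Longrightarrow> \<omega> \<in> \<Omega> \<Longrightarrow>
      x (i + 1) \<omega> = proj X (x i \<omega> - \<eta> i *\<^sub>R clip (U (x i \<omega>) (B i \<omega>)) (l i))"
    and "i \<ge> 1"
  shows "\<exists>F \<in> PiM {1..<i} (\<lambda>_. N) \<rightarrow>\<^sub>M restrict_space borel X. \<forall>\<omega>\<in>\<Omega>. x i \<omega> = F (\<lambda>j\<in>{1..<i}. B j \<omega>)"
  using \<open>i \<ge> 1\<close>
proof (induction i rule: dec_induct)
  case base
  show ?case
    using X init by (intro bexI[of _ "\<lambda>_. x1"]) (auto simp: space_restrict_space)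
next
  case (step i)
  let ?H = "PiM {1..<Suc i} (\<lambda>_. N)"
  from step obtain F where F: "F \<in> PiM {1..<i} (\<lambda>_. N) \<rightarrow>\<^sub>M restrict_space borel X"
    "\<And>\<omega>. \<omega> \<in> \<Omega> \<Longrightarrow> x i \<omega> = F (\<lambda>j\<in>{1..<i}. B j \<omega>)" by blast
  define G where "G b = F (restrict b {1..<i})" for b
  have G: "G \<in> ?H \<rightarrow>\<^sub>M restrict_space borel X"
    unfolding G_def by (intro measurable_compose[OF measurable_restrict_subset F(1)]) auto
  then have [measurable]: "G \<in> ?H \<rightarrow>\<^sub>M borel"
    by (simp add: measurable_restrict_space2_iff)
  have b_i: "(\<lambda>b. b i) \<in> ?H \<rightarrow>\<^sub>M N"
    using step(1) by (intro measurable_component_singleton) auto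
  have [measurable]: "(\<lambda>b. U (G b) (b i)) \<in> borel_measurable ?H"
    using measurable_compose[OF measurable_Pair[OF G b_i] U] by simp
  show ?case
  proof (intro bexI ballI)
    show "(\<lambda>b. proj X (G b - \<eta> i *\<^sub>R clip (U (G b) (b i)) (l i))) \<in> ?H \<rightarrow>\<^sub>M restrict_space borel X"
    proof (rule measurable_compose[OF _ proj_borel_measurable])
      show "(\<lambda>b. G b - \<eta> i *\<^sub>R clip (U (G b) (b i)) (l i)) \<in> borel_measurable ?H" by measurable
    qed (use X in auto)
    fix \<omega> assume "\<omega> \<in> \<Omega>"
    moreover have "restrict (\<lambda>j\<in>{1..<Suc i}. B j \<omega>) {1..<i} = (\<lambda>j\<in>{1..<i}. B j \<omega>)"
      by (auto simp: fun_eq_iff)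
    ultimately show "x (Suc i) \<omega> = proj X (G (\<lambda>j\<in>{1..<Suc i}. B j \<omega>) - \<eta> i *\<^sub>R
        clip (U (G (\<lambda>j\<in>{1..<Suc i}. B j \<omega>)) ((\<lambda>j\<in>{1..<Suc i}. B j \<omega>) i)) (l i))"
      using assms(6)[of i \<omega>] F(2) step(1) by (simp add: G_def)
  qed
qed

section \<open>Law and mean of a mini-batch\<close>

text \<open>The right-hand side does not mention \<open>zeta\<close>. Any two batches of copies thus
  have the same joint law, and a noise bound for one batch transfers to all others.\<close>

lemma (in prob_space) distr_iid_copies:
  assumes "iid_copies M S xi J zeta" "J \<noteq> {}"
  shows "distr M (PiM J (\<lambda>_. S)) (\<lambda>\<omega>. \<lambda>j\<in>J. zeta j \<omega>) = PiM J (\<lambda>_. distr M S xi)"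
proof -
  have "indep_vars (\<lambda>_. S) zeta J" "\<And>j. j \<in> J \<Longrightarrow> distr M S (zeta j) = distr M S xi"
    using assms by (auto simp: iid_copies_def)
  moreover from this(1) have "\<And>j. j \<in> J \<Longrightarrow> zeta j \<in> M \<rightarrow>\<^sub>M S"
    by (auto simp: indep_vars_def)
  ultimately show ?thesis
    using indep_vars_iff_distr_eq_PiM'[OF assms(2), where M' = "\<lambda>_. S" and X = zeta] by (simp cong: PiM_cong)
qed

lemma (in prob_space) integral_batch_mean:
  fixes u :: "'h::{real_inner, banach, second_countable_topology} \<Rightarrow> 's \<Rightarrow> 'h"
  assumes zeta: "iid_copies M S xi {1..m} zeta" and "m \<ge> 1"
    and [measurable]: "xi \<in> M \<rightarrow>\<^sub>M S" "u y \<in> borel_measurable S"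
    and int: "integrable M (\<lambda>\<omega>. u y (xi \<omega>))"
  shows "integrable M (\<lambda>\<omega>. batch_mean m u y (\<lambda>j. zeta j \<omega>))"
    and "expectation (\<lambda>\<omega>. batch_mean m u y (\<lambda>j. zeta j \<omega>)) = expectation (\<lambda>\<omega>. u y (xi \<omega>))"
proof -
  have z [measurable]: "zeta j \<in> M \<rightarrow>\<^sub>M S" and d: "distr M S (zeta j) = distr M S xi" if "j \<in> {1..m}" for j
    using zeta that by (auto simp: iid_copies_def indep_vars_def)
  have "integrable M (\<lambda>\<omega>. u y (zeta j \<omega>)) \<and> expectation (\<lambda>\<omega>. u y (zeta j \<omega>)) = expectation (\<lambda>\<omega>. u y (xi \<omega>))"
    if j: "j \<in> {1..m}" for j
  proof -
    note [measurable] = z[OF j]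
    have "integrable (distr M S xi) (u y)"
      using int by (simp add: integrable_distr_eq)
    then show ?thesis
      using d[OF j] integrable_distr_eq[of "zeta j" M S "u y"] integral_distr[of "zeta j" M S "u y"]
        integral_distr[of xi M S "u y"] by simp
  qed
  note * = conjunct1[OF this] conjunct2[OF this]
  show "integrable M (\<lambda>\<omega>. batch_mean m u y (\<lambda>j. zeta j \<omega>))"
    unfolding batch_mean_def by (intro integrable_scaleR_right Bochner_Integration.integrable_sum *)
  have "expectation (\<lambda>\<omega>. batch_mean m u y (\<lambda>j. zeta j \<omega>)) =
      (1 / real m) *\<^sub>R (\<Sum>j=1..m. expectation (\<lambda>\<omega>. u y (xi \<omega>)))"
    unfolding batch_mean_def using * by (simp add: Bochner_Integration.integral_sum)
  also have "\<dots> = expectation (\<lambda>\<omega>. u y (xi \<omega>))"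
    using \<open>m \<ge> 1\<close> by (simp only: sum_constant_scaleR) simp
  finally show "expectation (\<lambda>\<omega>. batch_mean m u y (\<lambda>j. zeta j \<omega>)) = expectation (\<lambda>\<omega>. u y (xi \<omega>))" .
qed

lemma batch_mean_measurable:
  fixes u :: "'h::{real_inner, banach, second_countable_topology} \<Rightarrow> 's \<Rightarrow> 'h"
  assumes "(\<lambda>(y, s). u y s) \<in> K \<Otimes>\<^sub>M S \<rightarrow>\<^sub>M borel"
  shows "(\<lambda>(y, s). batch_mean m u y s) \<in> K \<Otimes>\<^sub>M PiM {1..m} (\<lambda>_. S) \<rightarrow>\<^sub>M borel"
proof -
  have "(\<lambda>w. u (fst w) (snd w j)) \<in> borel_measurable (K \<Otimes>\<^sub>M PiM {1..m} (\<lambda>_. S))" if "j \<in> {1..m}" for j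
  proof -
    have "(\<lambda>w. (fst w, snd w j)) \<in> K \<Otimes>\<^sub>M PiM {1..m} (\<lambda>_. S) \<rightarrow>\<^sub>M K \<Otimes>\<^sub>M S"
      using that by (intro measurable_Pair measurable_fst measurable_compose[OF measurable_snd] measurable_component_singleton)
    from measurable_compose[OF this assms] show ?thesis by simp
  qed
  then show ?thesis
    unfolding batch_mean_def case_prod_beta by (intro borel_measurable_scaleR borel_measurable_sum) auto
qed

text \<open>Nonnegativity of the variance.\<close>

lemma (in prob_space) expectation_le_sqrt:
  fixes X :: "'a \<Rightarrow> real"
  assumes "integrable M X" "integrable M (\<lambda>\<omega>. (X \<omega>)\<^sup>2)"
  shows "expectation X \<le> sqrt (expectation (\<lambda>\<omega>. (X \<omega>)\<^sup>2))"
  using variance_positive[of X] assms by (simp add: variance_eq real_le_rsqrt)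

subsection \<open>Step-size rates and deterministic recursions\<close>

text \<open>Here \<open>\<kappa>\<close> stands for k^(1/p), \<open>c\<close> for 1 + 1/\<epsilon>
  and \<open>s\<close> for the noise bound. The step contributes \<theta> / \<kappa> and the bias
  (\<theta> / \<kappa>)^(p-1), so the exponents add up to \<open>p\<close>.\<close>

lemma clipping_bias_rate:
  fixes \<gamma> \<theta> \<kappa> :: real
  assumes "\<gamma> > 0" "\<theta> > 0" "\<kappa> > 0" "lam > 0" "c > 0" "s \<ge> 0" "p > 1" "l \<ge> lam * \<kappa> / \<theta>"
  shows "2 * (\<gamma> * \<theta> / \<kappa>) * ((c / l) powr (p - 1) * s)
    \<le> \<gamma> * (\<theta> powr p / \<kappa> powr p) * (2 * (c powr (p - 1) * s) / lam powr (p - 1))"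
proof -
  have "(c / l) powr (p - 1) \<le> (c / (lam * \<kappa> / \<theta>)) powr (p - 1)"
  proof (intro powr_mono2 divide_left_mono)
    have "lam * \<kappa> / \<theta> > 0" using assms by simp
    with assms(8) have "l > 0" by linarith
    with \<open>lam * \<kappa> / \<theta> > 0\<close> assms show "0 < l * (lam * \<kappa> / \<theta>)" "0 \<le> c / l" by (blast intro: mult_pos_pos, simp)
  qed (use assms in auto)
  also have "\<dots> = c powr (p - 1) * \<theta> powr (p - 1) / (lam powr (p - 1) * \<kappa> powr (p - 1))"
    using assms by (simp add: powr_divide powr_mult)
  finally have "2 * (\<gamma> * \<theta> / \<kappa>) * ((c / l) powr (p - 1) * s) \<le>
      2 * (\<gamma> * \<theta> / \<kappa>) * (c powr (p - 1) * \<theta> powr (p - 1) / (lam powr (p - 1) * \<kappa> powr (p - 1)) * s)"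
    using assms by (intro mult_left_mono mult_right_mono) auto
  also have "\<dots> = \<gamma> * (\<theta> powr p / \<kappa> powr p) * (2 * (c powr (p - 1) * s) / lam powr (p - 1))"
    using assms by (simp add: powr_diff field_simps)
  finally show ?thesis .
qed

text \<open>The squared step contributes (\<theta> / \<kappa>)^2 and the second moment (\<kappa> /
  \<theta>)^(2-p). The exponent \<open>p\<close> results again, now because the level is inversely
  proportional to \<theta>.\<close>

lemma clipping_moment_rate:
  fixes \<gamma> \<theta> \<kappa> :: real
  assumes "\<theta> > 0" "\<kappa> > 0" "c > 0" "b \<ge> 0" "p \<le> 2" "0 \<le> l" "l \<le> c * \<kappa> / \<theta>"
  shows "(\<gamma> * \<theta> / \<kappa>)\<^sup>2 * (l powr (2 - p) * b) \<le> \<gamma>\<^sup>2 * (\<theta> powr p / \<kappa> powr p) * (b * c powr (2 - p))"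
proof -
  have "l powr (2 - p) \<le> (c * \<kappa> / \<theta>) powr (2 - p)"
    using assms by (intro powr_mono2) auto
  also have "\<dots> = c powr (2 - p) * (\<kappa> powr 2 / \<kappa> powr p) / (\<theta> powr 2 / \<theta> powr p)"
    using assms by (simp add: powr_divide powr_mult powr_diff)
  finally have "(\<gamma> * \<theta> / \<kappa>)\<^sup>2 * (l powr (2 - p) * b) \<le>
      (\<gamma> * \<theta> / \<kappa>)\<^sup>2 * (c powr (2 - p) * (\<kappa> powr 2 / \<kappa> powr p) / (\<theta> powr 2 / \<theta> powr p) * b)"
    using assms by (intro mult_left_mono mult_right_mono) auto
  also have "\<dots> = \<gamma>\<^sup>2 * (\<theta> powr p / \<kappa> powr p) * (b * c powr (2 - p))"
    using assms by (simp add: power_mult_distrib power_divide)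
  finally show ?thesis .
qed

text \<open>The bound A is chosen with d^2 + \<alpha> A + \<beta> \<le> A^2. The induction carries a
  finer claim, linear growth from d^2 with increment (\<alpha> A + \<beta>) / k; up to index k it
  keeps the square root below A, which is what justifies the next increment.\<close>

lemma sqrt_recursion_le:
  fixes a :: "nat \<Rightarrow> real"
  assumes a: "a 1 = d\<^sup>2" "\<And>i. a i \<ge> 0"
    and step: "\<And>i. 1 \<le> i \<Longrightarrow> i < k \<Longrightarrow> a (Suc i) \<le> a i + (\<alpha> * sqrt (a i) + \<beta>) / real k"
    and nonneg: "\<alpha> \<ge> 0" "\<beta> \<ge> 0" "d \<ge> 0"
    and i: "1 \<le> i" "i \<le> k"
  shows "sqrt (a i) \<le> d + \<alpha> + sqrt \<beta>"
proof -
  define A where "A = d + \<alpha> + sqrt \<beta>"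
  have A: "A \<ge> 0" "d\<^sup>2 + \<alpha> * A + \<beta> \<le> A\<^sup>2"
  proof -
    have "A\<^sup>2 - \<alpha> * A = A * (d + sqrt \<beta>)"
      by (simp add: A_def power2_eq_square algebra_simps)
    also have "A * (d + sqrt \<beta>) \<ge> (d + sqrt \<beta>) * (d + sqrt \<beta>)"
      using nonneg by (intro mult_right_mono) (auto simp: A_def)
    moreover have "(d + sqrt \<beta>) * (d + sqrt \<beta>) \<ge> d\<^sup>2 + \<beta>"
      using nonneg by (simp add: algebra_simps power2_eq_square)
    ultimately show "d\<^sup>2 + \<alpha> * A + \<beta> \<le> A\<^sup>2" by linarith
  qed (use nonneg in \<open>simp add: A_def\<close>)
  have sqrt_le: "sqrt b \<le> A" if "b \<le> d\<^sup>2 + (\<alpha> * A + \<beta>) * (real (i - 1) / real k)" "i \<le> k" for i b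
  proof -
    have "real (i - 1) / real k \<le> 1" using that(2) by (auto simp: divide_le_eq_1)
    then have "(\<alpha> * A + \<beta>) * (real (i - 1) / real k) \<le> \<alpha> * A + \<beta>"
      using nonneg A by (intro mult_left_le) auto
    then show ?thesis using that A by (intro real_le_lsqrt) auto
  qed
  have "a i \<le> d\<^sup>2 + (\<alpha> * A + \<beta>) * (real (i - 1) / real k)"
    using i
  proof (induction i rule: dec_induct)
    case (step i)
    then have "i < k" and IH: "a i \<le> d\<^sup>2 + (\<alpha> * A + \<beta>) * (real (i - 1) / real k)" by auto
    have "a (Suc i) \<le> a i + (\<alpha> * sqrt (a i) + \<beta>) / real k"
      using assms(3) step \<open>i < k\<close> by blast
    also have "\<dots> \<le> d\<^sup>2 + (\<alpha> * A + \<beta>) * (real (i - 1) / real k) + (\<alpha> * A + \<beta>) / real k"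
      using IH sqrt_le[OF IH] \<open>i < k\<close> nonneg by (intro add_mono divide_right_mono mult_left_mono) auto
    also have "\<dots> = d\<^sup>2 + (\<alpha> * A + \<beta>) * (real (Suc i - 1) / real k)"
      using step by (simp add: of_nat_diff field_simps)
    finally show ?case .
  qed (use a in simp)
  from sqrt_le[OF this i(2)] show ?thesis by (simp add: A_def)
qed

lemma telescoped_sum_le:
  fixes a g e :: "nat \<Rightarrow> real"
  assumes "\<And>i. t \<le> i \<Longrightarrow> i \<le> s \<Longrightarrow> a (Suc i) \<le> a i - g i + e i" "a (Suc s) \<ge> 0" "t \<le> Suc s"
  shows "(\<Sum>i=t..s. g i) \<le> a t + (\<Sum>i=t..s. e i)"
proof -
  have "(\<Sum>i=t..s. g i - e i) \<le> (\<Sum>i=t..s. a i - a (Suc i))"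
    using assms(1) by (intro sum_mono) (force simp: algebra_simps)
  also have "\<dots> = a t - a (Suc s)"
    using sum_Suc_diff[OF assms(3), of a] by (simp add: sum_subtractf)
  finally show ?thesis using assms(2) by (simp add: sum_subtractf)
qed

subsection \<open>Epochs\<close>

text \<open>Rounding up before halving does not change the rounded half. The real ceilings in the
  epoch bounds thereby obey an integer recurrence.\<close>

lemma nat_ceiling_half:
  fixes y :: real
  assumes "y > 0"
  shows "nat \<lceil>y / 2\<rceil> = (nat \<lceil>y\<rceil> + 1) div 2"
proof -
  define c where "c = \<lceil>y\<rceil>"
  have c: "of_int c - 1 < y" "y \<le> of_int c" "c > 0"
    using assms by (auto simp: c_def) linarith
  have "\<lceil>y / 2\<rceil> = (c + 1) div 2"
  proof (rule ceiling_unique)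
    have "2 * ((c + 1) div 2) \<le> c + 1" "c \<le> 2 * ((c + 1) div 2)" by simp_all
    then have "2 * real_of_int ((c + 1) div 2) \<le> of_int c + 1" "of_int c \<le> 2 * real_of_int ((c + 1) div 2)"
      by linarith+
    then show "real_of_int ((c + 1) div 2) - 1 < y / 2" "y / 2 \<le> real_of_int ((c + 1) div 2)"
      using c by linarith+
  qed
  then show ?thesis
    using c(3) by (simp add: c_def nat_div_distrib nat_add_distrib)
qed

context
  fixes k :: nat
  assumes k_pos: "k \<ge> 1"
begin

text \<open>For \<open>j \<le> last_epoch k\<close> this is \<open>k - epoch_bound k j\<close>, the
  number of iterations left when epoch \<open>j\<close> begins.\<close>

definition remaining :: "nat \<Rightarrow> nat" where
  "remaining j = nat \<lceil>real k / 2 ^ j\<rceil>"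

lemma remaining_0: "remaining 0 = k"
  by (simp add: remaining_def)

lemma remaining_Suc: "remaining (Suc j) = (remaining j + 1) div 2"
  using nat_ceiling_half[of "real k / 2 ^ j"] k_pos by (simp add: remaining_def field_simps)

lemma remaining_pos: "remaining j \<ge> 1"
  by (induction j) (use k_pos in \<open>auto simp: remaining_0 remaining_Suc\<close>)

lemma remaining_Suc_le: "remaining (Suc j) \<le> remaining j"
  using remaining_pos[of j] by (simp add: remaining_Suc)

lemma remaining_le: "remaining j \<le> k"
  by (induction j) (auto simp: remaining_0 intro: order_trans[OF remaining_Suc_le])

lemma remaining_last: "remaining (last_epoch k) = 1"
proof -
  have "log 2 (real k) \<le> real (last_epoch k)"
    using k_pos by (simp add: last_epoch_def)
  then have "real k \<le> 2 powr real (last_epoch k)"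
    using k_pos by (simp add: log_le_iff)
  then have "real k / 2 ^ last_epoch k \<le> 1"
    by (simp add: powr_realpow)
  then show ?thesis
    using remaining_pos[of "last_epoch k"] unfolding remaining_def by linarith
qed

lemma remaining_before_last: "j < last_epoch k \<Longrightarrow> remaining j \<ge> 2"
proof -
  assume "j < last_epoch k"
  then have "real j < log 2 (real k)"
    unfolding last_epoch_def by linarith
  then have "2 powr real j < real k"
    using k_pos by (simp add: less_log_iff)
  then have "real k / 2 ^ j > 1"
    by (simp add: powr_realpow)
  then show ?thesis
    unfolding remaining_def by linarith
qed

lemma epoch_bound_eq: "epoch_bound k j = (if j \<le> last_epoch k then k - remaining j else k)"
  by (simp add: epoch_bound_def remaining_def)

lemma epoch_bound_0: "epoch_bound k 0 = 0"
  by (simp add: epoch_bound_eq remaining_0)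

lemma epoch_bound_last: "epoch_bound k (last_epoch k) = k - 1"
  by (simp add: epoch_bound_eq remaining_last)

lemma epoch_bound_end: "epoch_bound k (Suc (last_epoch k)) = k"
  by (simp add: epoch_bound_eq)

lemma epoch_bound_Suc:
  "epoch_bound k (Suc j) = epoch_bound k j + (if j < last_epoch k then remaining j div 2
     else if j = last_epoch k then 1 else 0)"
  using remaining_le[of j] remaining_le[of "Suc j"] remaining_last k_pos remaining_Suc[of j] 
    remaining_pos[of j] remaining_pos[of "Suc j"]
  by (auto simp: epoch_bound_eq)

lemma epoch_bound_strict: "j \<le> last_epoch k \<Longrightarrow> epoch_bound k j < epoch_bound k (Suc j)"
  using remaining_before_last[of j] by (auto simp: epoch_bound_Suc div_greater_zero_iff)

text \<open>If the next epoch has length q \<ge> 1 and is not the last, then at most 2q + 1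
  iterations remain at its start, and this number bounds the length of the current epoch; 2q + 1
  \<le> 3q. The factor 3 is attained when 6 iterations remain: lengths 3 and 1.\<close>

lemma epoch_ratio:
  assumes "j < last_epoch k"
  shows "epoch_bound k (Suc j) - epoch_bound k j \<le> 3 * (epoch_bound k (Suc (Suc j)) - epoch_bound k (Suc j))"
proof (cases "Suc j = last_epoch k")
  case True
  then have "(remaining j + 1) div 2 = 1"
    using remaining_last remaining_Suc[of j] by simp
  then have "remaining j \<le> 2" by linarith
  moreover have "epoch_bound k (Suc j) = epoch_bound k j + remaining j div 2"
    "epoch_bound k (Suc (Suc j)) = epoch_bound k (Suc j) + 1"
    using True assms epoch_bound_Suc[of j] epoch_bound_Suc[of "Suc j"] by simp_all
  ultimately show ?thesis by linarith
next
  case False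
  then have "Suc j < last_epoch k" using assms by simp
  then have "remaining (Suc j) \<ge> 2" by (rule remaining_before_last)
  then have "remaining j div 2 \<le> 3 * (remaining (Suc j) div 2)"
  proof -
    define q where "q = remaining (Suc j) div 2"
    have "q \<ge> 1" "remaining (Suc j) \<le> 2 * q + 1"
      using \<open>remaining (Suc j) \<ge> 2\<close> unfolding q_def by linarith+
    moreover have "remaining j \<le> 2 * remaining (Suc j)"
      unfolding remaining_Suc by linarith
    ultimately have "remaining j div 2 \<le> 2 * q + 1" by linarith
    then show ?thesis using \<open>q \<ge> 1\<close> by (simp add: q_def)
  qed
  then show ?thesis using \<open>Suc j < last_epoch k\<close> assms by (simp add: epoch_bound_Suc)
qed

text \<open>The right-hand side is twice the sum of the weights \<theta> over the first two epochs,
  so that sum is at least k / 2. Already the first iteration of the second epoch makes up for the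
  rounding of k / 2.\<close>

lemma first_epochs:
  assumes "last_epoch k \<noteq> 0"
  shows "k \<le> epoch_bound k 1 + epoch_bound k 2"
proof -
  have 1: "epoch_bound k (Suc 0) = k div 2"
    using assms by (simp add: epoch_bound_Suc epoch_bound_0 remaining_0)
  have "epoch_bound k (Suc 0) < epoch_bound k (Suc (Suc 0))"
    using assms by (intro epoch_bound_strict) auto
  then have "epoch_bound k 2 > k div 2" "epoch_bound k 1 = k div 2"
    using 1 by (simp_all add: numeral_2_eq_2)
  then show ?thesis by linarith
qed

end

section \<open>From weighted epoch sums to the last iterate\<close>

text \<open>The deterministic part of the argument: \<open>h\<close> is the expected optimality gap,
  \<open>init\<close> the summed recursion against the minimiser, and \<open>step\<close> the one
  against the iterate with index \<open>t\<close>, where no initial distance appears.\<close>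

lemma last_iterate_le:
  fixes b :: "nat \<Rightarrow> nat" and h \<theta> :: "nat \<Rightarrow> real"
  assumes b_0: "b 0 = 0" and b_last: "b n = k - 1" and b_end: "b (Suc n) = k"
    and b_less: "\<And>j. j \<le> n \<Longrightarrow> b j < b (Suc j)"
    and ratio: "\<And>j. j < n \<Longrightarrow> b (Suc j) - b j \<le> 3 * (b (Suc (Suc j)) - b (Suc j))"
    and first: "n \<noteq> 0 \<Longrightarrow> k \<le> b 1 + b 2"
    and \<theta>: "\<And>j i. j \<le> n \<Longrightarrow> i \<in> {b j + 1..b (Suc j)} \<Longrightarrow> \<theta> i = 1 / 2 ^ j"
    and p: "p > 1"
    and step: "\<And>t s. 1 \<le> t \<Longrightarrow> t \<le> s \<Longrightarrow> s \<le> k \<Longrightarrow>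
      (\<Sum>i=t..s. \<theta> i * (h i - h t)) \<le> c * (\<Sum>i=t..s. \<theta> i powr p)"
    and init: "\<And>s. s \<le> k \<Longrightarrow> (\<Sum>i=1..s. \<theta> i * h i) \<le> D + c * (\<Sum>i=1..s. \<theta> i powr p)"
    and c: "c \<ge> 0" and D: "D \<ge> 0"
  shows "h k \<le> 2 * D / k + c * (1 + 7 / (1 - (1/2) powr (p - 1)))"
proof -
  \<comment> \<open>Ratio of the geometric series: on epoch \<open>j\<close> the noise weight
    \<theta>^p is the step weight 1/2^j times r^j.\<close>
  define r :: real where "r = (1/2) powr (p - 1)"
  have r: "0 < r" "r < 1"
    using p powr_less_mono'[of "1/2" 0 "p - 1"] by (auto simp: r_def)
  define E where "E j = {b j + 1..b (Suc j)}" for j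
  define e where "e j = real (card (E j))" for j
  have k_pos: "k \<ge> 1" using b_less[of n] b_end by simp
  have e_eq: "e j = real (b (Suc j)) - real (b j)" if "j \<le> n" for j
    using b_less[OF that] by (simp add: e_def E_def of_nat_diff)
  have e_pos: "e j > 0" if "j \<le> n" for j
    using b_less[OF that] e_eq[OF that] by simp
  have b_le_k: "b j \<le> k" if "j \<le> Suc n" for j
    using that
  proof (induction rule: inc_induct)
    case (step m)
    then show ?case using b_less[of m] by simp
  qed (simp add: b_end)
  have powr_\<theta>: "\<theta> i powr p = r ^ j / 2 ^ j" if "j \<le> n" "i \<in> E j" for i j
  proof -
    have "\<theta> i powr p = (1 / 2 ^ j) powr (p - 1) * (1 / 2 ^ j)"
      using \<theta>[OF that(1)] that(2) by (simp add: E_def powr_diff)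
    also have "(1 / 2 ^ j) powr (p - 1) = r ^ j"
    proof -
      have "(1 / 2 ^ j :: real) = (1/2) powr real j"
        by (simp add: powr_realpow power_one_over)
      moreover have "r ^ j = r powr real j" using r by (simp add: powr_realpow)
      ultimately show ?thesis by (simp add: r_def powr_powr mult.commute)
    qed
    finally show ?thesis by simp
  qed
  have sum_powr_\<theta>: "(\<Sum>i\<in>E j. \<theta> i powr p) = e j * (r ^ j / 2 ^ j)" if "j \<le> n" for j
    using powr_\<theta>[OF that] by (simp add: e_def)
  have "\<exists>t\<in>E j. \<forall>i\<in>E j. h t \<le> h i" if "j \<le> n" for j
    using b_less[OF that] ex_min_if_finite[of "h ` E j"]
    by (force simp: E_def not_less)
  then obtain t where t: "\<And>j. j \<le> n \<Longrightarrow> t j \<in> E j" "\<And>j i. j \<le> n \<Longrightarrow> i \<in> E j \<Longrightarrow> h (t j) \<le> h i"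
    by metis
  have chain: "h (t (Suc j)) \<le> h (t j) + 7 * c * r ^ j" if "j < n" for j
  proof -
    define s where "s = b (Suc (Suc j))"
    have tj: "b j < t j" "t j \<le> b (Suc j)" "b (Suc j) < s"
      using t(1)[of j] that b_less[of "Suc j"] by (auto simp: E_def s_def)
    have split: "{t j..s} = {t j..b (Suc j)} \<union> E (Suc j)" "{t j..b (Suc j)} \<inter> E (Suc j) = {}"
      using tj by (auto simp: E_def s_def)
    have sub: "{t j..b (Suc j)} \<subseteq> E j" using tj by (auto simp: E_def)
    have "(\<Sum>i=t j..s. \<theta> i * (h i - h (t j))) \<le> c * (\<Sum>i=t j..s. \<theta> i powr p)"
      using tj b_le_k[of "Suc (Suc j)"] that by (intro step) (auto simp: s_def)
    \<comment> \<open>On the rest of epoch \<open>j\<close> all terms are nonnegative, because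
      \<open>t j\<close> is optimal there. On the next epoch every \<open>h i\<close> is at least
      its minimum.\<close>
    moreover have "e (Suc j) / 2 ^ Suc j * (h (t (Suc j)) - h (t j)) \<le> (\<Sum>i=t j..s. \<theta> i * (h i - h (t j)))"
    proof -
      have "0 \<le> (\<Sum>i=t j..b (Suc j). \<theta> i * (h i - h (t j)))"
        using sub t(2)[of j] \<theta>[of j] that by (intro sum_nonneg) (auto simp: E_def subset_iff)
      moreover have "(\<Sum>i\<in>E (Suc j). 1 / 2 ^ Suc j * (h (t (Suc j)) - h (t j))) \<le> (\<Sum>i\<in>E (Suc j). \<theta> i * (h i - h (t j)))"
      proof (rule sum_mono)
        fix i assume "i \<in> E (Suc j)"
        then show "1 / 2 ^ Suc j * (h (t (Suc j)) - h (t j)) \<le> \<theta> i * (h i - h (t j))"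
          using \<theta>[of "Suc j" i] t(2)[of "Suc j" i] that by (simp add: E_def divide_right_mono)
      qed
      ultimately show ?thesis
        using split by (simp add: sum.union_disjoint E_def e_def)
    qed
    moreover have "(\<Sum>i=t j..s. \<theta> i powr p) \<le> e (Suc j) / 2 ^ Suc j * (7 * r ^ j)"
    proof -
      have "(\<Sum>i=t j..s. \<theta> i powr p) = (\<Sum>i=t j..b (Suc j). \<theta> i powr p) + (\<Sum>i\<in>E (Suc j). \<theta> i powr p)"
        using split by (simp add: sum.union_disjoint E_def)
      also have "\<dots> \<le> (\<Sum>i\<in>E j. \<theta> i powr p) + (\<Sum>i\<in>E (Suc j). \<theta> i powr p)"
        using sub by (intro add_right_mono sum_mono2) (auto simp: E_def)
      also have "\<dots> = e j * (r ^ j / 2 ^ j) + e (Suc j) * (r ^ Suc j / 2 ^ Suc j)"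
        using that by (simp only: sum_powr_\<theta> Suc_leI less_imp_le)
      \<comment> \<open>3 / 2^j + 1 / 2^(j+1) = 7 / 2^(j+1).\<close>
      also have "\<dots> \<le> (3 * e (Suc j)) * (r ^ j / 2 ^ j) + e (Suc j) * (r ^ j / 2 ^ Suc j)"
      proof (intro add_mono mult_mono divide_right_mono)
        have "real (b (Suc j) - b j) \<le> real (3 * (b (Suc (Suc j)) - b (Suc j)))"
          using ratio[OF that] by (simp only: of_nat_le_iff)
        then show "e j \<le> 3 * e (Suc j)"
          using b_less[of j] b_less[of "Suc j"] that by (simp add: e_eq of_nat_diff)
        show "r ^ Suc j \<le> r ^ j" using r by (simp add: mult_le_cancel_right1)
      qed (use r e_pos[of j] e_pos[of "Suc j"] that in auto)
      also have "\<dots> = e (Suc j) / 2 ^ Suc j * (7 * r ^ j)"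
        by (simp add: field_simps)
      finally show ?thesis .
    qed
    ultimately have "e (Suc j) / 2 ^ Suc j * (h (t (Suc j)) - h (t j)) \<le> c * (e (Suc j) / 2 ^ Suc j * (7 * r ^ j))"
      using c by (meson mult_left_mono order_trans)
    then have "e (Suc j) / 2 ^ Suc j * (h (t (Suc j)) - h (t j)) \<le> e (Suc j) / 2 ^ Suc j * (7 * c * r ^ j)"
      by (simp add: algebra_simps)
    moreover have "e (Suc j) / 2 ^ Suc j > 0" using e_pos[of "Suc j"] that by simp
    ultimately have "h (t (Suc j)) - h (t j) \<le> 7 * c * r ^ j"
      by (simp only: mult_le_cancel_left_pos)
    then show ?thesis by simp
  qed
  have t_n: "t n = k"
    using t(1)[of n] b_last b_end k_pos by (simp add: E_def)
  show ?thesis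
  proof (cases "n = 0")
    case True
    then have "k = 1" using b_0 b_last k_pos by simp
    then have "h k \<le> D + c"
      using init[of 1] \<theta>[of 0 1] True b_0 b_end by simp
    moreover have "0 \<le> 7 * c / (1 - r)" using r c by simp
    ultimately show ?thesis
      using D \<open>k = 1\<close> by (simp add: r_def algebra_simps)
  next
    case False
    \<comment> \<open>The epoch \<open>E\<^sub>0\<close> alone is too short for the constant \<open>2 * D / k\<close> when \<open>k\<close> is odd, hence the start
      from the best iterate of the first two epochs.\<close>
    define m where "m = min (h (t 0)) (h (t 1))"
    have E01: "{1..b 2} = E 0 \<union> E 1" "E 0 \<inter> E 1 = {}"
      using b_less[of 0] b_less[of 1] False b_0 by (auto simp: E_def numeral_2_eq_2)
    have fin: "finite (E j)" for j by (simp add: E_def)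
    \<comment> \<open>\<open>e 0 + e 1 / 2\<close> is the sum of \<theta> over the two epochs. It
      also bounds the sum of \<theta>^p, so dividing by it leaves the noise cost
      \<open>c\<close>.\<close>
    have "m * (e 0 + e 1 / 2) \<le> D + c * (e 0 + e 1 / 2)"
    proof -
      have "m * (e 0 + e 1 / 2) = (\<Sum>i\<in>E 0. m) + (\<Sum>i\<in>E 1. 1 / 2 * m)"
        by (simp add: e_def algebra_simps)
      also have "\<dots> \<le> (\<Sum>i\<in>E 0. \<theta> i * h i) + (\<Sum>i\<in>E 1. \<theta> i * h i)"
      proof (intro add_mono sum_mono)
        show "m \<le> \<theta> i * h i" if "i \<in> E 0" for i
          using t(2)[of 0 i] \<theta>[of 0 i] that by (simp add: m_def E_def min_def)
        show "1 / 2 * m \<le> \<theta> i * h i" if "i \<in> E 1" for i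
        proof -
          have "\<theta> i = 1 / 2" using \<theta>[of 1 i] that False by (simp add: E_def)
          moreover have "m \<le> h i" using t(2)[of 1 i] that False by (simp add: m_def)
          ultimately show ?thesis by (simp only: mult_left_mono)
        qed
      qed
      also have "\<dots> = (\<Sum>i=1..b 2. \<theta> i * h i)"
        using E01 fin by (simp only: sum.union_disjoint)
      also have "\<dots> \<le> D + c * (\<Sum>i=1..b 2. \<theta> i powr p)"
        using b_le_k[of 2] False by (intro init) auto
      also have "(\<Sum>i=1..b 2. \<theta> i powr p) = (\<Sum>i\<in>E 0. \<theta> i powr p) + (\<Sum>i\<in>E 1. \<theta> i powr p)"
        using E01 fin by (simp only: sum.union_disjoint)
      also have "\<dots> = e 0 + e 1 * (r / 2)"
        using False by (simp add: sum_powr_\<theta>)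
      also have "e 0 + e 1 * (r / 2) \<le> e 0 + e 1 / 2"
        using r e_pos[of 1] False by (simp add: mult_le_cancel_left1)
      finally show ?thesis using c by (simp add: mult_left_mono)
    qed
    moreover have "real k / 2 \<le> e 0 + e 1 / 2"
    proof -
      have "real k \<le> real (b 1) + real (b 2)"
        using first[OF False] by linarith
      moreover have "e 0 = real (b 1)" "e 1 = real (b 2) - real (b 1)"
        using e_eq[of 0] e_eq[of 1] b_0 False by (simp_all add: numeral_2_eq_2)
      ultimately show ?thesis by (simp add: field_simps)
    qed
    ultimately have m_le: "m \<le> 2 * D / k + c"
    proof -
      define w where "w = e 0 + e 1 / 2"
      assume *: "m * (e 0 + e 1 / 2) \<le> D + c * (e 0 + e 1 / 2)" "real k / 2 \<le> e 0 + e 1 / 2"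
      have w: "w \<ge> real k / 2" "w > 0" "m * w \<le> D + c * w" using * k_pos by (auto simp: w_def)
      then have "m \<le> D / w + c" by (simp add: field_simps)
      also have "D / w \<le> D / (real k / 2)" using w D k_pos by (intro divide_left_mono) auto
      finally show ?thesis by (simp add: mult.commute)
    qed
    \<comment> \<open>The induction starts at 1 because \<open>m\<close> may be attained in either
      of the two epochs: from \<open>t 0\<close> one transition with cost \<open>7 * c\<close> leads
      to \<open>t 1\<close>, from \<open>t 1\<close> none is needed.\<close>
    have "h (t j) \<le> m + 7 * c * (\<Sum>i<j. r ^ i)" if "1 \<le> j" "j \<le> n" for j
      using that
    proof (induction j rule: dec_induct)
      case base
      have "h (t 1) \<le> h (t 0) + 7 * c" using chain[of 0] False by simp
      then show ?case using c by (simp add: m_def min_def)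
    next
      case (step j)
      then show ?case using chain[of j] by (simp add: algebra_simps)
    qed
    from this[of n] have "h k \<le> m + 7 * c * (\<Sum>i<n. r ^ i)"
      using False t_n by simp
    also have "(\<Sum>i<n. r ^ i) \<le> 1 / (1 - r)"
      using r by (simp add: sum_gp_strict divide_right_mono)
    finally have "h k \<le> m + 7 * c * (1 / (1 - r))"
      using c by (simp add: mult_left_mono)
    then show ?thesis
      using m_le by (simp add: r_def algebra_simps)
  qed
qed

subsection \<open>The convergence rate\<close>

theorem theorem3:
  fixes f :: "'h::{real_inner, banach, second_countable_topology} \<Rightarrow> real"
    and X :: "'h set"
    and M :: "'w measure" and S :: "'s measure"
    and xi :: "'w \<Rightarrow> 's" and u :: "'h \<Rightarrow> 's \<Rightarrow> 'h"
    and zeta :: "nat \<Rightarrow> 'w \<Rightarrow> 's"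
    and Xi :: "nat \<Rightarrow> nat \<Rightarrow> 'w \<Rightarrow> 's"
    and x :: "nat \<Rightarrow> 'w \<Rightarrow> 'h"
    and x1 xstar :: 'h
    and stepsize level :: "nat \<Rightarrow> real"
    and m k :: nat
    and L p \<sigma> \<sigma>m \<epsilon> \<gamma> lam ap bp L\<epsilon> vp wp :: real
  assumes f_convex: "convex_on UNIV f"
    and L_pos: "L > 0"
    and f_Lipschitz: "L-lipschitz_on UNIV f"
    and X_nonempty: "X \<noteq> {}" and X_closed: "closed X" and X_convex: "convex X"
    and xstar: "is_arg_min f (\<lambda>y. y \<in> X) xstar"
    and M_prob: "prob_space M"
    and xi_rv: "xi \<in> M \<rightarrow>\<^sub>M S"
    and u_measurable: "(\<lambda>(y, s). u y s) \<in> restrict_space borel X \<Otimes>\<^sub>M S \<rightarrow>\<^sub>M borel"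
    and u_integrable: "\<And>y. y \<in> X \<Longrightarrow> integrable M (\<lambda>\<omega>. u y (xi \<omega>))"
    and u_subgrad: "\<And>y. y \<in> X \<Longrightarrow> (\<integral>\<omega>. u y (xi \<omega>) \<partial>M) \<in> subdifferential f y"
    and p_range: "1 < p" "p \<le> 2"
    and \<sigma>_nonneg: "\<sigma> \<ge> 0"
    and noise: "\<And>y. y \<in> X \<Longrightarrow>
      (\<integral>\<^sup>+\<omega>. ennreal (norm (u y (xi \<omega>) - (\<integral>\<omega>'. u y (xi \<omega>') \<partial>M)) powr p) \<partial>M)
        \<le> ennreal (\<sigma> powr p)"
    and m_pos: "m \<ge> 1"
    and \<epsilon>_pos: "\<epsilon> > 0"
    and zeta: "iid_copies M S xi {1..m} zeta"
    and \<sigma>m_nonneg: "\<sigma>m \<ge> 0"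
    and batch_noise: "\<And>y. y \<in> X \<Longrightarrow>
      (\<integral>\<^sup>+\<omega>. ennreal (norm (batch_mean m u y (\<lambda>j. zeta j \<omega>)
          - (\<integral>\<omega>'. batch_mean m u y (\<lambda>j. zeta j \<omega>') \<partial>M)) powr p) \<partial>M)
        \<le> ennreal (\<sigma>m powr p)"
    and ap: "ap = (1 + 1 / \<epsilon>) powr (p - 1) * \<sigma>m powr p"
    and bp: "bp = 2 powr (p - 1) * (\<sigma>m powr p + L powr p)"
    and L\<epsilon>: "L\<epsilon> = (1 + \<epsilon>) * L"
    \<comment> \<open>the clipped stochastic subgradient method\<close>
    and batch_iid: "\<And>i. i \<ge> 1 \<Longrightarrow> iid_copies M S xi {1..m} (Xi i)"
    and batches_indep: "prob_space.indep_vars M (\<lambda>_. PiM {1..m} (\<lambda>_. S))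
      (\<lambda>i \<omega>. \<lambda>j\<in>{1..m}. Xi i j \<omega>) {1..}"
    and steps_pos: "\<And>i. i \<ge> 1 \<Longrightarrow> stepsize i > 0" "\<And>i. i \<ge> 1 \<Longrightarrow> level i > 0"
    and x1: "x1 \<in> X"
    and x_init: "\<And>\<omega>. \<omega> \<in> space M \<Longrightarrow> x 1 \<omega> = x1"
    and x_step: "\<And>i \<omega>. i \<ge> 1 \<Longrightarrow> \<omega> \<in> space M \<Longrightarrow>
      x (i + 1) \<omega> = proj X (x i \<omega> -
        stepsize i *\<^sub>R clip (batch_mean m u (x i \<omega>) (\<lambda>j. Xi i j \<omega>)) (level i))"
    \<comment> \<open>horizon and epoch-wise constant parameters\<close>
    and k_pos: "k \<ge> 1"
    and \<gamma>_pos: "\<gamma> > 0" and lam_pos: "lam > 0"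
    and stepsize: "\<And>j i. j \<le> last_epoch k \<Longrightarrow> i \<in> epoch k j \<Longrightarrow>
      stepsize i = \<gamma> / (2 ^ j * real k powr (1 / p))"
    and level: "\<And>j i. j \<le> last_epoch k \<Longrightarrow> i \<in> epoch k j \<Longrightarrow>
      level i = 2 ^ j * max L\<epsilon> (lam * real k powr (1 / p))"
    and vp: "vp = 4 * ap / lam powr (p - 1)"
    and wp: "wp = bp * max L\<epsilon> lam powr (2 - p)"
  shows "integrable M (\<lambda>\<omega>. f (x k \<omega>)) \<and>
    (\<integral>\<omega>. f (x k \<omega>) \<partial>M) - (INF y\<in>X. f y) \<le>
      1 / real k powr ((p - 1) / p) *
        (6 / 5 * ((norm (x1 - xstar))\<^sup>2 / \<gamma>) +
         53 / 10 * (2 powr (p - 1) / (2 powr (p - 1) - 1)) *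
           (norm (x1 - xstar) * vp + \<gamma> * (vp + sqrt wp)\<^sup>2))"
proof -
  interpret prob_space M by (rule M_prob)

  \<comment> \<open>Mini-batches and iterates as random elements\<close>
  define N where "N = PiM {1..m} (\<lambda>_. S)"
  define U where "U = batch_mean m u"
  define B where "B i \<omega> = (\<lambda>j\<in>{1..m}. Xi i j \<omega>)" for i \<omega>
  define BX where "BX = restrict_space borel X"
  define H where "H i = PiM {1..<i} (\<lambda>_::nat. N)" for i
  define hist where "hist i \<omega> = (\<lambda>j\<in>{1..<i}. B j \<omega>)" for i \<omega>

  have p_pos: "p > 0" using p_range by simp
  have U_restrict: "U y (\<lambda>j\<in>{1..m}. s j) = batch_mean m u y s" for y s
    by (simp add: U_def batch_mean_def)
  have U_meas: "(\<lambda>(y, s). U y s) \<in> BX \<Otimes>\<^sub>M N \<rightarrow>\<^sub>M borel"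
    unfolding U_def BX_def N_def by (rule batch_mean_measurable[OF u_measurable])
  have U_y [measurable]: "U y \<in> borel_measurable N" if "y \<in> X" for y
    using measurable_compose[OF measurable_Pair1'[of y BX N] U_meas] that
    by (simp add: BX_def space_restrict_space)
  have u_y: "u y \<in> borel_measurable S" if "y \<in> X" for y
    using measurable_compose[OF measurable_Pair1'[of y BX S] u_measurable[folded BX_def]] that
    by (simp add: BX_def space_restrict_space)

  have law: "distr M N (B i) = PiM {1..m} (\<lambda>_. distr M S xi)" if "i \<ge> 1" for i
    unfolding N_def B_def using m_pos by (intro distr_iid_copies batch_iid that) auto
  \<comment> \<open>\<open>T\<close> is the batch of the noise hypothesis. Every \<open>B i\<close>
    has its law, so integrability, mean and noise of \<open>U y\<close> are read off
    \<open>T\<close> once for all \<open>i\<close>.\<close>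
  define T where "T \<omega> = (\<lambda>j\<in>{1..m}. zeta j \<omega>)" for \<omega>
  have law_T: "distr M N T = PiM {1..m} (\<lambda>_. distr M S xi)"
    unfolding N_def T_def using m_pos by (intro distr_iid_copies zeta) auto
  have T_meas: "T \<in> M \<rightarrow>\<^sub>M N"
    using zeta unfolding T_def N_def iid_copies_def indep_vars_def by (intro measurable_restrict) auto
  have B_meas: "B i \<in> M \<rightarrow>\<^sub>M N" if "i \<ge> 1" for i
    using batches_indep that by (auto simp: indep_vars_def B_def[abs_def] N_def)
  have U_T: "integrable M (\<lambda>\<omega>. U y (T \<omega>))" "expectation (\<lambda>\<omega>. U y (T \<omega>)) = expectation (\<lambda>\<omega>. u y (xi \<omega>))"
    if "y \<in> X" for y
    using integral_batch_mean[where u = u and y = y, OF zeta m_pos xi_rv u_y[OF that] u_integrable[OF that]]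
    unfolding T_def U_restrict .
  have U_int: "integrable (distr M N (B i)) (U y)" if "i \<ge> 1" "y \<in> X" for i y
    unfolding law[OF that(1)] law_T[symmetric] using U_T(1) that
    by (subst integrable_distr_eq[OF T_meas U_y]) auto
  have U_mean: "(\<integral>s. U y s \<partial>distr M N (B i)) = expectation (\<lambda>\<omega>. U y (T \<omega>))" if "i \<ge> 1" "y \<in> X" for i y
    unfolding law[OF that(1)] law_T[symmetric] using that
    by (subst integral_distr[OF T_meas U_y]) auto
  have U_sub: "(\<integral>s. U y s \<partial>distr M N (B i)) \<in> subdifferential f y" if "i \<ge> 1" "y \<in> X" for i y
    using U_mean[OF that] U_T(2)[OF that(2)] u_subgrad[OF that(2)] by simp
  have U_noise: "(\<integral>\<^sup>+s. ennreal (norm (U y s - (\<integral>s. U y s \<partial>distr M N (B i))) powr p) \<partial>distr M N (B i))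
      \<le> ennreal (\<sigma>m powr p)" if "i \<ge> 1" "y \<in> X" for i y
  proof -
    have [measurable]: "U y \<in> borel_measurable N" using U_y that by simp
    show ?thesis
      unfolding U_mean[OF that] unfolding law[OF that(1)] law_T[symmetric]
      using batch_noise[OF that(2)]
      by (subst nn_integral_distr[OF T_meas]) (measurable, simp only: T_def U_restrict)
  qed

  have x_step': "x (i + 1) \<omega> = proj X (x i \<omega> - stepsize i *\<^sub>R clip (U (x i \<omega>) (B i \<omega>)) (level i))"
    if "i \<ge> 1" "\<omega> \<in> space M" for i \<omega>
    using x_step[OF that] unfolding B_def U_restrict .
  have x_in: "x i \<omega> \<in> X" if "i \<ge> 1" "\<omega> \<in> space M" for i \<omega>
    using that(1)
    by (induction rule: dec_induct)
      (use x_init x1 x_step' that proj_in[OF X_closed X_convex X_nonempty] in auto)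
  have "\<exists>F \<in> H i \<rightarrow>\<^sub>M BX. \<forall>\<omega>\<in>space M. x i \<omega> = F (hist i \<omega>)" if "i \<ge> 1" for i
    unfolding H_def BX_def hist_def
    by (rule iterate_measurable_history[where x = x and U = U and \<eta> = stepsize and B = B and l = level
          and \<Omega> = "space M", OF X_closed X_convex x1 U_meas[unfolded BX_def] x_init x_step' that])
  then obtain F where F: "\<And>i. i \<ge> 1 \<Longrightarrow> F i \<in> H i \<rightarrow>\<^sub>M BX"
    "\<And>i \<omega>. i \<ge> 1 \<Longrightarrow> \<omega> \<in> space M \<Longrightarrow> x i \<omega> = F i (hist i \<omega>)" by metis
  have hist_meas: "hist i \<in> M \<rightarrow>\<^sub>M H i" for i
    unfolding hist_def H_def by (intro measurable_restrict B_meas) auto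
  have x_BX: "x i \<in> M \<rightarrow>\<^sub>M BX" if "i \<ge> 1" for i
    using measurable_compose[OF hist_meas F(1)[OF that]] F(2)[OF that] by (simp cong: measurable_cong)
  have x_meas [measurable]: "x i \<in> borel_measurable M" if "i \<ge> 1" for i
    using x_BX[OF that] by (simp add: BX_def measurable_restrict_space2_iff)
  have f_meas [measurable]: "f \<in> borel_measurable borel"
    using f_Lipschitz by (intro borel_measurable_continuous_onI lipschitz_on_continuous_on)

  \<comment> \<open>A clipped step has length at most \<open>stepsize i * level i\<close>, so each
    iterate is surely bounded. These bounds depend on \<open>i\<close> and serve integrability; the
    rate rests on \<open>A\<close> below.\<close>
  have "\<exists>R. \<forall>\<omega>\<in>space M. norm (x i \<omega> - x1) \<le> R" if "i \<ge> 1" for i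
    using that
  proof (induction rule: dec_induct)
    case base
    then show ?case using x_init by auto
  next
    case (step i)
    then obtain R where R: "\<And>\<omega>. \<omega> \<in> space M \<Longrightarrow> norm (x i \<omega> - x1) \<le> R" by auto
    have "norm (x (Suc i) \<omega> - x1) \<le> R + stepsize i * level i" if "\<omega> \<in> space M" for \<omega>
    proof -
      define v where "v = clip (U (x i \<omega>) (B i \<omega>)) (level i)"
      have "norm (x (Suc i) \<omega> - x1) \<le> norm ((x i \<omega> - x1) - stepsize i *\<^sub>R v)"
        using proj_nonexpansive[OF X_closed X_convex X_nonempty, of "x i \<omega> - stepsize i *\<^sub>R v" x1]
          proj_self[OF X_closed X_convex x1] x_step'[OF step(1) that]
        by (simp add: dist_norm v_def algebra_simps)
      also have "\<dots> \<le> norm (x i \<omega> - x1) + norm (stepsize i *\<^sub>R v)"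
        by (rule norm_triangle_ineq4)
      also have "\<dots> \<le> R + stepsize i * level i"
        using R[OF that] steps_pos[OF step(1)] by (intro add_mono) (auto simp: v_def norm_clip)
      finally show ?thesis .
    qed
    then show ?case by blast
  qed
  then obtain R where R: "\<And>i \<omega>. i \<ge> 1 \<Longrightarrow> \<omega> \<in> space M \<Longrightarrow> norm (x i \<omega> - x1) \<le> R i" by metis
  have f_x_int: "integrable M (\<lambda>\<omega>. f (x i \<omega>))" if "i \<ge> 1" for i
  proof (rule integrable_const_bound)
    show "AE \<omega> in M. norm (f (x i \<omega>)) \<le> \<bar>f x1\<bar> + L * R i"
    proof (rule AE_I2)
      fix \<omega> assume "\<omega> \<in> space M"
      then have "L * norm (x i \<omega> - x1) \<le> L * R i" using R[OF that] L_pos by simp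
      then show "norm (f (x i \<omega>)) \<le> \<bar>f x1\<bar> + L * R i"
        using lipschitz_onD[OF f_Lipschitz, of "x i \<omega>" x1] by (simp add: dist_norm)
    qed
    show "(\<lambda>\<omega>. f (x i \<omega>)) \<in> borel_measurable M"
      using measurable_compose[OF x_meas[OF that] f_meas] .
  qed

  \<comment> \<open>The one-step inequality in terms of \<theta>, \<kappa> and k\<close>
  define \<kappa> where "\<kappa> = real k powr (1 / p)"
  define \<Lambda> where "\<Lambda> = max L\<epsilon> (lam * \<kappa>)"
  \<comment> \<open>Defined through the step size, which avoids a function from iterations to epoch
    numbers; on epoch \<open>j\<close> the value is 1/2^j.\<close>
  define \<theta> where "\<theta> i = stepsize i * \<kappa> / \<gamma>" for i
  have \<kappa>: "\<kappa> \<ge> 1" "\<kappa> powr p = real k" "\<kappa> > 0"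
    using k_pos p_range by (auto simp: \<kappa>_def powr_powr ge_one_powr_ge_zero)
  have L\<epsilon>_pos: "L\<epsilon> > 0" using L\<epsilon> L_pos \<epsilon>_pos by simp
  have \<theta>_epoch: "\<theta> i = 1 / 2 ^ j" if "j \<le> last_epoch k" "i \<in> epoch k j" for i j
    using stepsize[OF that] \<gamma>_pos \<kappa> by (simp add: \<theta>_def \<kappa>_def)
  have in_epoch: "\<exists>j\<le>last_epoch k. i \<in> epoch k j" if "i \<in> {1..k}" for i
  proof -
    have "i \<le> epoch_bound k j \<Longrightarrow> j \<le> Suc (last_epoch k) \<Longrightarrow> \<exists>j\<le>last_epoch k. i \<in> epoch k j" for j
    proof (induction j)
      case 0
      then show ?case using that epoch_bound_0[OF k_pos] by simp
    next
      case (Suc j)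
      then show ?case
        by (cases "i \<le> epoch_bound k j") (auto simp: epoch_def)
    qed
    from this[of "Suc (last_epoch k)"] show ?thesis
      using that epoch_bound_end[OF k_pos] by simp
  qed
  have params: "stepsize i = \<gamma> * \<theta> i / \<kappa>" "level i = \<Lambda> / \<theta> i" "0 < \<theta> i" "\<theta> i \<le> 1"
    if i: "i \<in> {1..k}" for i
  proof -
    obtain j where j: "j \<le> last_epoch k" "i \<in> epoch k j" using in_epoch[OF i] by blast
    show "stepsize i = \<gamma> * \<theta> i / \<kappa>" using \<gamma>_pos \<kappa> by (simp add: \<theta>_def)
    show "level i = \<Lambda> / \<theta> i" "0 < \<theta> i" "\<theta> i \<le> 1"
      using level[OF j] \<theta>_epoch[OF j] by (simp_all add: \<Lambda>_def \<kappa>_def mult.commute)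
  qed

  have ap_nonneg: "ap \<ge> 0" and bp_nonneg: "bp \<ge> 0" by (simp_all add: ap bp)
  have vp_nonneg: "vp \<ge> 0" and wp_nonneg: "wp \<ge> 0"
    using ap_nonneg bp_nonneg by (simp_all add: vp wp)

  \<comment> \<open>\<open>Z\<close> may be any bounded-distance reference determined by the batches
    before \<open>i\<close>, which covers both \<open>xstar\<close> and earlier iterates. The bias
    contributes \<open>2 * ap / lam powr (p - 1)\<close>, that is \<open>vp / 2\<close>.\<close>
  have one_step: "expectation (\<lambda>\<omega>. (norm (x (Suc i) \<omega> - Z \<omega>))\<^sup>2) \<le>
      expectation (\<lambda>\<omega>. (norm (x i \<omega> - Z \<omega>))\<^sup>2) - 2 * (\<gamma> / \<kappa>) * (\<theta> i * expectation (\<lambda>\<omega>. f (x i \<omega>) - f (Z \<omega>)))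
      + \<gamma> * (\<theta> i powr p / real k) * (vp / 2 * expectation (\<lambda>\<omega>. norm (x i \<omega> - Z \<omega>)) + \<gamma> * wp)"
    if i: "i \<in> {1..k}" and G: "G \<in> H i \<rightarrow>\<^sub>M BX" and Z: "\<And>\<omega>. \<omega> \<in> space M \<Longrightarrow> Z \<omega> = G (hist i \<omega>)"
      and bounded: "\<And>\<omega>. \<omega> \<in> space M \<Longrightarrow> norm (x i \<omega> - Z \<omega>) \<le> R'" for i G Z R'
  proof -
    have i1: "i \<ge> 1" using i by simp
    have Z_BX: "Z \<in> M \<rightarrow>\<^sub>M BX"
      using measurable_compose[OF hist_meas G] Z by (simp cong: measurable_cong)
    have joint: "distr M (BX \<Otimes>\<^sub>M BX) (\<lambda>\<omega>. (x i \<omega>, Z \<omega>)) \<Otimes>\<^sub>M distr M N (B i) =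
        distr M ((BX \<Otimes>\<^sub>M BX) \<Otimes>\<^sub>M N) (\<lambda>\<omega>. ((x i \<omega>, Z \<omega>), B i \<omega>))"
    proof (rule distr_history_pair)
      show "indep_vars (\<lambda>_. N) B {1..}"
        using batches_indep by (simp add: B_def[abs_def] N_def)
      show "(\<lambda>h. (F i h, G h)) \<in> PiM {1..<i} (\<lambda>_. N) \<rightarrow>\<^sub>M BX \<Otimes>\<^sub>M BX"
        using F(1)[OF i1] G unfolding H_def by (rule measurable_Pair)
    qed (use i F(2) Z in \<open>auto simp: hist_def\<close>)
    have lev: "level i \<ge> (1 + \<epsilon>) * L"
    proof -
      have "L\<epsilon> \<le> \<Lambda> / 1" by (simp add: \<Lambda>_def)
      also have "\<dots> \<le> \<Lambda> / \<theta> i"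
        using params[OF i] L\<epsilon>_pos by (intro divide_left_mono) (auto simp: \<Lambda>_def)
      finally show ?thesis using params[OF i] L\<epsilon> by simp
    qed
    have "expectation (\<lambda>\<omega>. (norm (x (Suc i) \<omega> - Z \<omega>))\<^sup>2) =
        expectation (\<lambda>\<omega>. (norm (proj X (x i \<omega> - stepsize i *\<^sub>R clip (U (x i \<omega>) (B i \<omega>)) (level i)) - Z \<omega>))\<^sup>2)"
      using x_step'[OF i1] by (intro Bochner_Integration.integral_cong) auto
    also have "\<dots> \<le> expectation (\<lambda>\<omega>. (norm (x i \<omega> - Z \<omega>))\<^sup>2) - 2 * stepsize i * expectation (\<lambda>\<omega>. f (x i \<omega>) - f (Z \<omega>))
      + 2 * stepsize i * (((1 + 1 / \<epsilon>) / level i) powr (p - 1) * \<sigma>m powr p) * expectation (\<lambda>\<omega>. norm (x i \<omega> - Z \<omega>))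
      + (stepsize i)\<^sup>2 * (level i powr (2 - p) * (2 powr (p - 1) * (\<sigma>m powr p + L powr p)))"
    proof (rule clipped_step_expectation_random[where X = X and U = U and T = "B i" and N = N and Y = "x i" and Z = Z])
      show "(\<lambda>\<omega>. (x i \<omega>, Z \<omega>)) \<in> M \<rightarrow>\<^sub>M restrict_space borel X \<Otimes>\<^sub>M restrict_space borel X"
        using x_BX[OF i1] Z_BX unfolding BX_def by (rule measurable_Pair)
    qed (fact B_meas[OF i1] joint[unfolded BX_def] U_meas[unfolded BX_def] U_int[OF i1] U_sub[OF i1] U_noise[OF i1]
        f_Lipschitz L_pos X_closed X_convex p_range \<epsilon>_pos lev steps_pos(1)[OF i1] bounded)+
    also have "\<dots> \<le> expectation (\<lambda>\<omega>. (norm (x i \<omega> - Z \<omega>))\<^sup>2)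
      - 2 * (\<gamma> / \<kappa>) * (\<theta> i * expectation (\<lambda>\<omega>. f (x i \<omega>) - f (Z \<omega>)))
      + \<gamma> * (\<theta> i powr p / real k) * (vp / 2) * expectation (\<lambda>\<omega>. norm (x i \<omega> - Z \<omega>))
      + \<gamma>\<^sup>2 * (\<theta> i powr p / real k) * wp"
    proof (intro add_mono mult_right_mono)
      show "2 * stepsize i * (((1 + 1 / \<epsilon>) / level i) powr (p - 1) * \<sigma>m powr p) \<le> \<gamma> * (\<theta> i powr p / real k) * (vp / 2)"
        using clipping_bias_rate[of \<gamma> "\<theta> i" \<kappa> lam "1 + 1 / \<epsilon>" "\<sigma>m powr p" p "level i"]
          params[OF i] \<gamma>_pos \<kappa> lam_pos \<epsilon>_pos p_range
        by (simp add: vp ap \<Lambda>_def divide_right_mono add_pos_pos mult.commute[of "\<sigma>m powr p"])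
      \<comment> \<open>As \<kappa> \<ge> 1, it can be pulled out of both arguments of the maximum;
        the form of \<open>wp\<close> comes from this.\<close>
      have "\<Lambda> \<le> max L\<epsilon> lam * \<kappa>"
      proof -
        have "L\<epsilon> * 1 \<le> max L\<epsilon> lam * \<kappa>" using \<kappa> L\<epsilon>_pos by (intro mult_mono) auto
        moreover have "lam * \<kappa> \<le> max L\<epsilon> lam * \<kappa>" using \<kappa> by (intro mult_right_mono) auto
        ultimately show ?thesis by (simp add: \<Lambda>_def)
      qed
      then have "level i \<le> max L\<epsilon> lam * \<kappa> / \<theta> i"
        using params[OF i] by (simp add: divide_right_mono)
      then show "(stepsize i)\<^sup>2 * (level i powr (2 - p) * (2 powr (p - 1) * (\<sigma>m powr p + L powr p)))
          \<le> \<gamma>\<^sup>2 * (\<theta> i powr p / real k) * wp"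
        using clipping_moment_rate[of "\<theta> i" \<kappa> "max L\<epsilon> lam" bp p "level i" \<gamma>]
          params[OF i] \<kappa> lam_pos p_range bp_nonneg steps_pos(2)[OF i1]
        by (simp add: wp bp less_imp_le)
    qed (use params[OF i] in \<open>auto simp: mult_ac\<close>)
    also have "\<dots> = expectation (\<lambda>\<omega>. (norm (x i \<omega> - Z \<omega>))\<^sup>2)
      - 2 * (\<gamma> / \<kappa>) * (\<theta> i * expectation (\<lambda>\<omega>. f (x i \<omega>) - f (Z \<omega>)))
      + \<gamma> * (\<theta> i powr p / real k) * (vp / 2 * expectation (\<lambda>\<omega>. norm (x i \<omega> - Z \<omega>)) + \<gamma> * wp)"
      by (simp add: algebra_simps power2_eq_square)
    finally show ?thesis .
  qed

  \<comment> \<open>A priori bound on the distance to the minimiser\<close>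
  have xstar_X: "xstar \<in> X" and xstar_min: "\<And>y. y \<in> X \<Longrightarrow> f xstar \<le> f y"
    using xstar by (auto simp: is_arg_min_linorder)
  have INF_eq: "(INF y\<in>X. f y) = f xstar"
    using xstar_X xstar_min by (intro cInf_eq_minimum) auto
  define h where "h i = expectation (\<lambda>\<omega>. f (x i \<omega>)) - f xstar" for i
  have h_nonneg: "h i \<ge> 0" if "i \<ge> 1" for i
  proof -
    have "expectation (\<lambda>\<omega>. f xstar) \<le> expectation (\<lambda>\<omega>. f (x i \<omega>))"
      using f_x_int[OF that] x_in[OF that] xstar_min by (intro integral_mono) auto
    then show ?thesis by (simp add: h_def prob_space)
  qed
  define d where "d = norm (x1 - xstar)"
  define a where "a i = (if i \<ge> 1 then expectation (\<lambda>\<omega>. (norm (x i \<omega> - xstar))\<^sup>2) else 0)" for i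
  have dist_bound: "norm (x i \<omega> - xstar) \<le> R i + d" if "i \<ge> 1" "\<omega> \<in> space M" for i \<omega>
    using norm_triangle_ineq[of "x i \<omega> - x1" "x1 - xstar"] R[OF that] by (simp add: d_def)
  have dist_int: "integrable M (\<lambda>\<omega>. norm (x i \<omega> - xstar))" "integrable M (\<lambda>\<omega>. (norm (x i \<omega> - xstar))\<^sup>2)"
    if "i \<ge> 1" for i
  proof -
    note [measurable] = x_meas[OF that]
    show "integrable M (\<lambda>\<omega>. norm (x i \<omega> - xstar))"
      using dist_bound[OF that] by (intro integrable_const_bound[of _ "R i + d"]) auto
    show "integrable M (\<lambda>\<omega>. (norm (x i \<omega> - xstar))\<^sup>2)"
      using dist_bound[OF that] by (intro integrable_const_bound[of _ "(R i + d)\<^sup>2"]) (auto intro!: power_mono)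
  qed
  have E_dist: "expectation (\<lambda>\<omega>. norm (x i \<omega> - xstar)) \<le> sqrt (a i)" if "i \<ge> 1" for i
    using expectation_le_sqrt[OF dist_int[OF that]] that by (simp add: a_def)
  have xstar_BX: "(\<lambda>_. xstar) \<in> H i \<rightarrow>\<^sub>M BX" for i
    using xstar_X by (simp add: BX_def space_restrict_space)
  have E_f_xstar: "expectation (\<lambda>\<omega>. f (x i \<omega>) - f xstar) = h i" if "i \<ge> 1" for i
    using f_x_int[OF that] by (simp add: h_def prob_space)
  have step_xstar: "expectation (\<lambda>\<omega>. (norm (x (Suc i) \<omega> - xstar))\<^sup>2) \<le>
      expectation (\<lambda>\<omega>. (norm (x i \<omega> - xstar))\<^sup>2) - 2 * (\<gamma> / \<kappa>) * (\<theta> i * h i)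
      + \<gamma> * (\<theta> i powr p / real k) * (vp / 2 * expectation (\<lambda>\<omega>. norm (x i \<omega> - xstar)) + \<gamma> * wp)"
    if "i \<in> {1..k}" for i
    using one_step[OF that xstar_BX, of "\<lambda>_. xstar" "R i + d"] dist_bound[of i] E_f_xstar[of i] that by simp

  \<comment> \<open>The bound of the square-root recursion with \<alpha> = \<gamma> vp / 2 and
    \<beta> = \<gamma>^2 wp. In that recursion the gap \<open>h i\<close> is dropped and \<theta>^p
    is replaced by 1.\<close>
  define A where "A = d + \<gamma> * vp / 2 + \<gamma> * sqrt wp"
  have A_nonneg: "A \<ge> 0" using vp_nonneg wp_nonneg \<gamma>_pos by (simp add: A_def d_def)
  have sqrt_a: "sqrt (a i) \<le> A" if "i \<in> {1..k}" for i
  proof -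
    have "sqrt (a i) \<le> d + \<gamma> * vp / 2 + sqrt (\<gamma>\<^sup>2 * wp)"
    proof (rule sqrt_recursion_le)
      show "a 1 = d\<^sup>2"
        using x_init by (simp add: a_def d_def prob_space cong: Bochner_Integration.integral_cong)
      show "a i \<ge> 0" for i by (simp add: a_def)
      fix i assume i: "1 \<le> i" "i < k"
      then have ik: "i \<in> {1..k}" by simp
      have "a (Suc i) \<le> a i - 2 * (\<gamma> / \<kappa>) * (\<theta> i * h i)
          + \<gamma> * (\<theta> i powr p / real k) * (vp / 2 * expectation (\<lambda>\<omega>. norm (x i \<omega> - xstar)) + \<gamma> * wp)"
        using step_xstar[OF ik] i by (simp add: a_def)
      also have "\<dots> \<le> a i - 0 + \<gamma> * (1 / real k) * (vp / 2 * sqrt (a i) + \<gamma> * wp)"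
      proof (intro add_mono diff_mono mult_mono divide_right_mono)
        show "0 \<le> 2 * (\<gamma> / \<kappa>) * (\<theta> i * h i)"
          using \<gamma>_pos \<kappa> params[OF ik] h_nonneg[OF i(1)] by simp
        show "\<theta> i powr p \<le> 1"
          using params[OF ik] p_range powr_mono2[of p "\<theta> i" 1] by simp
        show "expectation (\<lambda>\<omega>. norm (x i \<omega> - xstar)) \<le> sqrt (a i)" by (rule E_dist[OF i(1)])
      qed (use \<gamma>_pos vp_nonneg wp_nonneg in \<open>auto intro!: add_nonneg_nonneg mult_nonneg_nonneg\<close>)
      also have "\<dots> = a i + (\<gamma> * vp / 2 * sqrt (a i) + \<gamma>\<^sup>2 * wp) / real k"
        using k_pos by (simp add: field_simps power2_eq_square)
      finally show "a (Suc i) \<le> a i + (\<gamma> * vp / 2 * sqrt (a i) + \<gamma>\<^sup>2 * wp) / real k" .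
    qed (use that \<gamma>_pos vp_nonneg wp_nonneg in \<open>auto simp: d_def\<close>)
    then show ?thesis using \<gamma>_pos by (simp add: A_def real_sqrt_mult)
  qed

  \<comment> \<open>A noise constant valid for every reference point used. By the triangle
    inequality through \<open>xstar\<close>, mean distances between iterates are at most
    \<open>2 * A\<close>; \<open>n0\<close> exceeds the noise at this distance by \<gamma> vp^2 / 2
    + \<gamma> vp sqrt wp.\<close>
  define n0 where "n0 = d * vp + \<gamma> * (vp + sqrt wp)\<^sup>2"
  have n0_nonneg: "n0 \<ge> 0" using vp_nonneg \<gamma>_pos by (simp add: n0_def d_def)
  have noise_le: "vp / 2 * e + \<gamma> * wp \<le> n0" if "e \<le> 2 * A" for e
  proof -
    have "vp / 2 * e \<le> vp / 2 * (2 * A)" using that vp_nonneg by (intro mult_left_mono) auto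
    moreover have "\<gamma> * (vp * sqrt wp) \<ge> 0" "\<gamma> * vp\<^sup>2 \<ge> 0" using \<gamma>_pos vp_nonneg wp_nonneg by auto
    moreover have "n0 = d * vp + \<gamma> * vp\<^sup>2 + 2 * (\<gamma> * (vp * sqrt wp)) + \<gamma> * wp"
      using wp_nonneg by (simp add: n0_def power2_sum algebra_simps)
    moreover have "vp / 2 * (2 * A) = d * vp + \<gamma> * vp\<^sup>2 / 2 + \<gamma> * (vp * sqrt wp)"
      by (simp add: A_def algebra_simps power2_eq_square)
    ultimately show ?thesis by linarith
  qed
  \<comment> \<open>Both constants arise by dividing the telescoped recursion by 2 \<gamma> /
    \<kappa>, the coefficient of the gap.\<close>
  define c where "c = \<kappa> * n0 / (2 * real k)"
  define D where "D = \<kappa> * d\<^sup>2 / (2 * \<gamma>)"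

  \<comment> \<open>Shared by both kinds of reference: \<open>b\<close> is the mean squared distance
    to it, \<open>q\<close> the gap in function values and \<open>e\<close> the mean
    distance.\<close>
  have summed: "(\<Sum>i=t..s. \<theta> i * q i) \<le> \<kappa> / (2 * \<gamma>) * b t + c * (\<Sum>i=t..s. \<theta> i powr p)"
    if ts: "1 \<le> t" "t \<le> Suc s" "s \<le> k" and b: "b (Suc s) \<ge> 0"
      and bq: "\<And>i. t \<le> i \<Longrightarrow> i \<le> s \<Longrightarrow>
        \<exists>e\<le>2 * A. b (Suc i) \<le> b i - 2 * (\<gamma> / \<kappa>) * (\<theta> i * q i) + \<gamma> * (\<theta> i powr p / real k) * (vp / 2 * e + \<gamma> * wp)"
    for t s b q
  proof -
    have "(\<Sum>i=t..s. 2 * (\<gamma> / \<kappa>) * (\<theta> i * q i)) \<le> b t + (\<Sum>i=t..s. \<gamma> * (\<theta> i powr p / real k) * n0)"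
    proof (rule telescoped_sum_le[where a = b])
      fix i assume i: "t \<le> i" "i \<le> s"
      then obtain e where e: "e \<le> 2 * A" "b (Suc i) \<le> b i - 2 * (\<gamma> / \<kappa>) * (\<theta> i * q i)
          + \<gamma> * (\<theta> i powr p / real k) * (vp / 2 * e + \<gamma> * wp)"
        using bq by blast
      have "\<gamma> * (\<theta> i powr p / real k) * (vp / 2 * e + \<gamma> * wp) \<le> \<gamma> * (\<theta> i powr p / real k) * n0"
        using noise_le[OF e(1)] \<gamma>_pos by (intro mult_left_mono) auto
      with e(2) show "b (Suc i) \<le> b i - 2 * (\<gamma> / \<kappa>) * (\<theta> i * q i) + \<gamma> * (\<theta> i powr p / real k) * n0"
        by linarith
    qed (use b ts(2) in auto)
    then have "\<kappa> / (2 * \<gamma>) * (2 * (\<gamma> / \<kappa>) * (\<Sum>i=t..s. \<theta> i * q i)) \<le>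
        \<kappa> / (2 * \<gamma>) * (b t + \<gamma> * n0 / real k * (\<Sum>i=t..s. \<theta> i powr p))"
      using \<gamma>_pos \<kappa> by (intro mult_left_mono) (simp_all add: sum_distrib_left mult_ac)
    then show ?thesis
      using \<gamma>_pos \<kappa> by (simp add: c_def distrib_left field_simps)
  qed

  have init: "(\<Sum>i=1..s. \<theta> i * h i) \<le> D + c * (\<Sum>i=1..s. \<theta> i powr p)" if "s \<le> k" for s
  proof -
    have "(\<Sum>i=1..s. \<theta> i * h i) \<le> \<kappa> / (2 * \<gamma>) * a 1 + c * (\<Sum>i=1..s. \<theta> i powr p)"
    proof (rule summed)
      fix i assume i: "1 \<le> i" "i \<le> s"
      then have ik: "i \<in> {1..k}" using that by simp
      have "expectation (\<lambda>\<omega>. norm (x i \<omega> - xstar)) \<le> 2 * A"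
        using E_dist[OF i(1)] sqrt_a[OF ik] A_nonneg by linarith
      then show "\<exists>e\<le>2 * A. a (Suc i) \<le> a i - 2 * (\<gamma> / \<kappa>) * (\<theta> i * h i)
          + \<gamma> * (\<theta> i powr p / real k) * (vp / 2 * e + \<gamma> * wp)"
        using step_xstar[OF ik] i by (intro exI[of _ "expectation (\<lambda>\<omega>. norm (x i \<omega> - xstar))"]) (simp add: a_def)
    qed (use that in \<open>auto simp: a_def\<close>)
    moreover have "a 1 = d\<^sup>2"
      using x_init by (simp add: a_def d_def prob_space cong: Bochner_Integration.integral_cong)
    ultimately show ?thesis by (simp add: D_def)
  qed

  have step: "(\<Sum>i=t..s. \<theta> i * (h i - h t)) \<le> c * (\<Sum>i=t..s. \<theta> i powr p)"
    if ts: "1 \<le> t" "t \<le> s" "s \<le> k" for t s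
  proof -
    have "(\<Sum>i=t..s. \<theta> i * (h i - h t)) \<le>
        \<kappa> / (2 * \<gamma>) * expectation (\<lambda>\<omega>. (norm (x t \<omega> - x t \<omega>))\<^sup>2) + c * (\<Sum>i=t..s. \<theta> i powr p)"
    proof (rule summed[of t s "\<lambda>i. expectation (\<lambda>\<omega>. (norm (x i \<omega> - x t \<omega>))\<^sup>2)"])
      fix i assume i: "t \<le> i" "i \<le> s"
      then have ik: "i \<in> {1..k}" "i \<ge> 1" and tk: "t \<in> {1..k}" using ts by auto
      \<comment> \<open>Since t \<le> i, the batches before t are among those before i; restricting
        the longer history exhibits x_t as a function of it.\<close>
      define G where "G b = F t (restrict b {1..<t})" for b
      have G: "G \<in> H i \<rightarrow>\<^sub>M BX"
        unfolding G_def H_def using i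
        by (intro measurable_compose[OF measurable_restrict_subset F(1)[OF ts(1), unfolded H_def]]) auto
      have xt: "x t \<omega> = G (hist i \<omega>)" if "\<omega> \<in> space M" for \<omega>
      proof -
        have "restrict (hist i \<omega>) {1..<t} = hist t \<omega>" using i by (auto simp: hist_def fun_eq_iff)
        then show ?thesis using F(2)[OF ts(1) that] by (simp add: G_def)
      qed
      have tri: "norm (x i \<omega> - x t \<omega>) \<le> norm (x i \<omega> - xstar) + norm (x t \<omega> - xstar)" for \<omega>
        using norm_triangle_ineq4[of "x i \<omega> - xstar" "x t \<omega> - xstar"] by simp
      have bounded: "norm (x i \<omega> - x t \<omega>) \<le> R i + d + (R t + d)" if "\<omega> \<in> space M" for \<omega>
        using tri[of \<omega>] dist_bound[OF ik(2) that] dist_bound[OF ts(1) that] by linarith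
      have "expectation (\<lambda>\<omega>. norm (x i \<omega> - x t \<omega>)) \<le>
          expectation (\<lambda>\<omega>. norm (x i \<omega> - xstar) + norm (x t \<omega> - xstar))"
        using dist_int(1)[OF ik(2)] dist_int(1)[OF ts(1)] tri by (intro integral_mono') auto
      also have "\<dots> \<le> 2 * A"
        using dist_int(1)[OF ik(2)] dist_int(1)[OF ts(1)] E_dist[OF ik(2)] E_dist[OF ts(1)] sqrt_a[OF ik(1)] sqrt_a[OF tk]
        by simp
      finally have e: "expectation (\<lambda>\<omega>. norm (x i \<omega> - x t \<omega>)) \<le> 2 * A" .
      have "expectation (\<lambda>\<omega>. f (x i \<omega>) - f (x t \<omega>)) = h i - h t"
        using f_x_int[OF ik(2)] f_x_int[OF ts(1)] by (simp add: h_def)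
      with one_step[OF ik(1) G xt bounded] e
      show "\<exists>e\<le>2 * A. expectation (\<lambda>\<omega>. (norm (x (Suc i) \<omega> - x t \<omega>))\<^sup>2) \<le>
          expectation (\<lambda>\<omega>. (norm (x i \<omega> - x t \<omega>))\<^sup>2) - 2 * (\<gamma> / \<kappa>) * (\<theta> i * (h i - h t))
          + \<gamma> * (\<theta> i powr p / real k) * (vp / 2 * e + \<gamma> * wp)"
        by (intro exI[of _ "expectation (\<lambda>\<omega>. norm (x i \<omega> - x t \<omega>))"]) simp
    qed (use ts in auto)
    then show ?thesis by simp
  qed

  \<comment> \<open>Assembling the rate\<close>
  define C where "C = 2 powr (p - 1) / (2 powr (p - 1) - 1)"
  have "2 powr (p - 1) > 1" using p_range by simp
  then have C: "C \<ge> 1" "1 / (1 - (1/2) powr (p - 1)) = C"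
    by (simp_all add: C_def powr_divide field_simps)
  have "h k \<le> 2 * D / k + c * (1 + 7 / (1 - (1/2) powr (p - 1)))"
  proof (rule last_iterate_le[where b = "epoch_bound k" and n = "last_epoch k" and \<theta> = \<theta>])
    show "\<theta> i = 1 / 2 ^ j" if "j \<le> last_epoch k" "i \<in> {epoch_bound k j + 1..epoch_bound k (Suc j)}" for i j
      using \<theta>_epoch[OF that(1)] that(2) by (simp add: epoch_def)
    show "c \<ge> 0" "D \<ge> 0" using \<kappa> n0_nonneg \<gamma>_pos by (simp_all add: c_def D_def)
  qed (use k_pos epoch_bound_0 epoch_bound_last epoch_bound_end epoch_bound_strict epoch_ratio first_epochs
      p_range step init in auto)
  also have "\<dots> = \<kappa> / real k * (d\<^sup>2 / \<gamma> + n0 / 2 * (1 + 7 * C))"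
  proof -
    have "7 / (1 - (1/2) powr (p - 1)) = 7 * C" by (simp flip: C(2))
    then show ?thesis using k_pos \<gamma>_pos by (simp add: D_def c_def field_simps)
  qed
  \<comment> \<open>\<open>C \<ge> 1\<close> gives (1 + 7 C) / 2 \<le> 4 C, and 4 is below
    53/10.\<close>
  also have "\<dots> \<le> \<kappa> / real k * (6 / 5 * (d\<^sup>2 / \<gamma>) + 53 / 10 * C * n0)"
  proof (intro mult_left_mono add_mono)
    have "1 / 2 * (1 + 7 * C) * n0 \<le> 53 / 10 * C * n0"
      using C(1) n0_nonneg by (intro mult_right_mono) auto
    then show "n0 / 2 * (1 + 7 * C) \<le> 53 / 10 * C * n0" by simp
    have "1 * (d\<^sup>2 / \<gamma>) \<le> 6 / 5 * (d\<^sup>2 / \<gamma>)"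
      using \<gamma>_pos by (intro mult_right_mono) auto
    then show "d\<^sup>2 / \<gamma> \<le> 6 / 5 * (d\<^sup>2 / \<gamma>)" by simp
  qed (use \<kappa> \<gamma>_pos in auto)
  also have "\<kappa> / real k = 1 / real k powr ((p - 1) / p)"
    using k_pos p_pos by (simp add: \<kappa>_def diff_divide_distrib powr_diff)
  finally show ?thesis
    using f_x_int[OF k_pos] by (simp add: INF_eq h_def d_def C_def n0_def)
qed

end
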